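(* Let $m\ge1$, $r\ge2$, $a\ge0$ be integers, and for each $i\in[m]$ let $b_i,c_i,d_i$ be integers with $0\le d_i\le c_i\le b_i\le r$ and $b_i+c_i-d_i\le r$. Assume $a+\sum_{i\in[m]}b_i\le r$ and $a+\sum_{i\in[m]}c_i\le r$. Then $$\pi\bigl(T^r_{a,b_1,c_1,d_1,\ldots,b_m,c_m,d_m}\bigr)\le\max_{i\in[m]}\frac{\Psi(r,b_i,L_i)}{\binom{r}{b_i}},$$ where $L_i\coloneqq[0,d_i-1]\cup[b_i-c_i+d_i+1,b_i]$ for $i\in[m]$.
   Context: Integer intervals: $[q]=\{1,\dots,q\}$ and $[p,q]=\{p,p+1,\dots,q\}$, with $[p,q]=\emptyset$ if $p>q$. For $r\ge2$, an $r$-graph is a family of $r$-subsets (edges) of a vertex set; $|H|$ is the number of edges of $H$. For an $r$-graph $F$, $H$ is $F$-free if it does not contain $F$ as a (not necessarily induced) subgraph; $\mathrm{ex}(n,F)=\max\{|H|: |V(H)|=n,\ H\text{ is }F\text{-free}\}$, and the Turán density is $\pi(F)=\lim_{n\to\infty}\mathrm{ex}(n,F)/\binom nr$. A partial hypergraph is a finite vertex set together with a finite collection $e_1,\dots,e_t$ of subsets of it (partial edges, not necessarily of the same size). If all $|e_j|\le r$, its $r$-uniform extension is the $r$-graph obtained by adding, for each $j\in[t]$, a private set $U_j$ of $r-|e_j|$ new vertices (the $U_j$ pairwise disjoint) and taking as edges the sets $e_j\cup U_j$, $j\in[t]$. Definition of $T^r_{a,b_1,c_1,d_1,\ldots,b_m,c_m,d_m}$: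 choose pairwise disjoint $r$-sets $E_1,\dots,E_m$, a set $A$ disjoint from their union with $|A|=a$, and $B_i,C_i\subseteq E_i$ with $|B_i|=b_i$, $|C_i|=c_i$, $|B_i\cap C_i|=d_i$ for every $i\in[m]$. The $r$-graph is the $r$-uniform extension of the partial hypergraph on $A\cup\bigcup_{i}E_i$ with partial edges $E_1,\dots,E_m$, $A\cup\bigcup_{i\in[m]}B_i$, $A\cup\bigcup_{i\in[m]}C_i$. For $L\subseteq[0,b]$, a family $\mathcal B\subseteq\binom{[r]}{b}$ is $L$-intersecting if $|B\cap B'|\in L$ for all distinct $B,B'\in\mathcal B$, and $\Psi(r,b,L)$ is the maximum of $|\mathcal B|$ over $L$-intersecting $\mathcal B\subseteq\binom{[r]}{b}$. *)

theory Defs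
  imports Complex_Main "HOL-Library.Disjoint_Sets"
begin

type_synonym 'v hypergraph = "'v set \<times> 'v set set"

definition is_r_graph :: "nat \<Rightarrow> 'v hypergraph \<Rightarrow> bool" where
  "is_r_graph r H \<longleftrightarrow> finite (fst H) \<and> (\<forall>e\<in>snd H. e \<subseteq> fst H \<and> card e = r)"

definition contains_copy :: "'w hypergraph \<Rightarrow> 'v hypergraph \<Rightarrow> bool" where
  "contains_copy H F \<longleftrightarrow>
     (\<exists>f. inj_on f (fst F) \<and> f ` fst F \<subseteq> fst H \<and> (\<forall>e\<in>snd F. f ` e \<in> snd H))"

text \<open>Host hypergraphs live on natural-number vertices, so every finite hypergraph
  is represented up to isomorphism.\<close>

definition turan_number :: "nat \<Rightarrow> nat \<Rightarrow> 'v hypergraph \<Rightarrow> nat" where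
  "turan_number r n F =
     Max {card (snd H) | H :: nat hypergraph.
            is_r_graph r H \<and> card (fst H) = n \<and> \<not> contains_copy H F}"

definition turan_density :: "nat \<Rightarrow> 'v hypergraph \<Rightarrow> real" where
  "turan_density r F = lim (\<lambda>n. real (turan_number r n F) / real (n choose r))"

text \<open>The partial edges are given as a list, since equal partial edges at different
  positions still receive separate sets of new vertices.\<close>

definition is_partial_hypergraph :: "'v set \<Rightarrow> 'v set list \<Rightarrow> bool" where
  "is_partial_hypergraph W es \<longleftrightarrow> finite W \<and> (\<forall>e\<in>set es. e \<subseteq> W)"

text \<open>The extension is determined only up to the choice of the new vertices, so it is
  a relation between a partial hypergraph and a hypergraph.\<close>

definition is_uniform_extension ::
    "nat \<Rightarrow> 'v set \<Rightarrow> 'v set list \<Rightarrow> 'v hypergraph \<Rightarrow> bool" where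
  "is_uniform_extension r W es F \<longleftrightarrow>
     is_partial_hypergraph W es \<and> (\<forall>e\<in>set es. card e \<le> r) \<and>
     (\<exists>U :: nat \<Rightarrow> 'v set.
        (\<forall>j<length es. finite (U j) \<and> card (U j) = r - card (es ! j) \<and> U j \<inter> W = {}) \<and>
        disjoint_family_on U {..<length es} \<and>
        F = (W \<union> (\<Union>j<length es. U j), {es ! j \<union> U j | j. j < length es}))"

text \<open>\<open>is_T r a m b c d F\<close> says that \<open>F\<close> is (a copy of)
  \<open>T\<^sup>r\<close> with parameters \<open>a, b\<^sub>1, c\<^sub>1, d\<^sub>1, \<dots>, b\<^sub>m, c\<^sub>m, d\<^sub>m\<close>.\<close>

definition is_T ::
    "nat \<Rightarrow> nat \<Rightarrow> nat \<Rightarrow> (nat \<Rightarrow> nat) \<Rightarrow> (nat \<Rightarrow> nat) \<Rightarrow> (nat \<Rightarrow> nat) \<Rightarrow> 'v hypergraph \<Rightarrow> bool"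
  where
  "is_T r a m b c d F \<longleftrightarrow>
     (\<exists>(E :: nat \<Rightarrow> 'v set) A B C.
        disjoint_family_on E {1..m} \<and> (\<forall>i\<in>{1..m}. finite (E i) \<and> card (E i) = r) \<and>
        finite A \<and> card A = a \<and> A \<inter> (\<Union>i\<in>{1..m}. E i) = {} \<and>
        (\<forall>i\<in>{1..m}. B i \<subseteq> E i \<and> C i \<subseteq> E i \<and>
           card (B i) = b i \<and> card (C i) = c i \<and> card (B i \<inter> C i) = d i) \<and>
        is_uniform_extension r (A \<union> (\<Union>i\<in>{1..m}. E i))
          (map E [1..<Suc m] @ [A \<union> (\<Union>i\<in>{1..m}. B i), A \<union> (\<Union>i\<in>{1..m}. C i)]) F)"

definition L_intersecting :: "nat set \<Rightarrow> 'a set set \<Rightarrow> bool" where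
  "L_intersecting L \<B> \<longleftrightarrow> (\<forall>B\<in>\<B>. \<forall>B'\<in>\<B>. B \<noteq> B' \<longrightarrow> card (B \<inter> B') \<in> L)"

definition Psi :: "nat \<Rightarrow> nat \<Rightarrow> nat set \<Rightarrow> nat" where
  "Psi r b L = Max {card \<B> | \<B>. \<B> \<subseteq> {B. B \<subseteq> {1..r} \<and> card B = b} \<and> L_intersecting L \<B>}"

text \<open>\<open>is_T\<close> is satisfiable for all admissible parameters, so a statement about
  every such \<open>F\<close> is not vacuous.\<close>

lemma uniform_extension_exists:
  fixes W :: "nat set"
  assumes "is_partial_hypergraph W es" "\<forall>e\<in>set es. card e \<le> r"
  shows "\<exists>F. is_uniform_extension r W es F"
proof -
  have "finite W" using assms(1) by (simp add: is_partial_hypergraph_def)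
  then obtain N where N: "\<forall>x\<in>W. x < N"
    using finite_nat_set_iff_bounded by blast
  define U where "U j = {N + j * r..<N + j * r + (r - card (es ! j))}" for j
  have "U i \<inter> U j = {}" if "i < j" for i j
  proof -
    have "Suc i * r \<le> j * r" using that by (intro mult_le_mono1) simp
    then show ?thesis by (auto simp: U_def)
  qed
  then have "disjoint_family_on U {..<length es}"
    unfolding disjoint_family_on_def by (metis inf_commute linorder_neqE_nat)
  moreover have "\<forall>j<length es. finite (U j) \<and> card (U j) = r - card (es ! j) \<and> U j \<inter> W = {}"
    using N by (force simp: U_def)
  ultimately show ?thesis
    unfolding is_uniform_extension_def using assms by blast
qed

lemma is_T_exists:
  assumes "\<forall>i\<in>{1..m}. d i \<le> c i \<and> c i \<le> b i \<and> b i \<le> r \<and> b i + c i - d i \<le> r"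
    and "a + (\<Sum>i\<in>{1..m}. b i) \<le> r" "a + (\<Sum>i\<in>{1..m}. c i) \<le> r"
  shows "\<exists>F :: nat hypergraph. is_T r a m b c d F"
proof -
  define E where "E i = {i * r..<i * r + r}" for i
  define A where "A = {Suc m * r..<Suc m * r + a}"
  define B where "B i = {i * r..<i * r + b i}" for i
  define C where "C i = {i * r + (b i - d i)..<i * r + (b i - d i) + c i}" for i
  have "E i \<inter> E j = {}" if "i < j" for i j
  proof -
    have "Suc i * r \<le> j * r" using that by (intro mult_le_mono1) simp
    then show ?thesis by (auto simp: E_def)
  qed
  then have disj: "disjoint_family_on E {1..m}"
    unfolding disjoint_family_on_def by (metis inf_commute linorder_neqE_nat)
  have E: "\<forall>i\<in>{1..m}. finite (E i) \<and> card (E i) = r" by (simp add: E_def)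
  have "A \<inter> E i = {}" if "i \<in> {1..m}" for i
  proof -
    have "Suc i * r \<le> Suc m * r" using that by (intro mult_le_mono1) simp
    then show ?thesis by (auto simp: A_def E_def)
  qed
  then have A3: "A \<inter> (\<Union>i\<in>{1..m}. E i) = {}" by blast
  have A: "finite A" "card A = a" by (simp_all add: A_def)
  have BC: "B i \<subseteq> E i \<and> C i \<subseteq> E i \<and> card (B i) = b i \<and> card (C i) = c i \<and> card (B i \<inter> C i) = d i"
    if "i \<in> {1..m}" for i
  proof -
    have le: "d i \<le> c i" "c i \<le> b i" "b i \<le> r" "b i + c i - d i \<le> r" using assms(1) that by auto
    then have "B i \<inter> C i = {i * r + (b i - d i)..<i * r + b i}"
      by (auto simp: B_def C_def)
    then show ?thesis using le by (auto simp: B_def C_def E_def)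
  qed
  have card_le: "card (A \<union> (\<Union>i\<in>{1..m}. X i)) \<le> a + (\<Sum>i\<in>{1..m}. x i)"
    if "\<forall>i\<in>{1..m}. card (X i) = x i" for X :: "nat \<Rightarrow> nat set" and x
  proof -
    have "card (\<Union>i\<in>{1..m}. X i) \<le> (\<Sum>i\<in>{1..m}. card (X i))" by (intro card_UN_le) simp
    also have "\<dots> = (\<Sum>i\<in>{1..m}. x i)" using that by (intro sum.cong) auto
    finally show ?thesis using card_Un_le[of A "\<Union>i\<in>{1..m}. X i"] A(2) by linarith
  qed
  let ?W = "A \<union> (\<Union>i\<in>{1..m}. E i)"
  let ?es = "map E [1..<Suc m] @ [A \<union> (\<Union>i\<in>{1..m}. B i), A \<union> (\<Union>i\<in>{1..m}. C i)]"
  have set_es: "set ?es = E ` {1..m} \<union> {A \<union> (\<Union>i\<in>{1..m}. B i), A \<union> (\<Union>i\<in>{1..m}. C i)}"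
    unfolding set_append set_map set_upt atLeastLessThanSuc_atLeastAtMost by simp
  have "is_partial_hypergraph ?W ?es"
    unfolding is_partial_hypergraph_def
  proof (intro conjI ballI)
    show "finite ?W" using A(1) E by blast
    fix e assume "e \<in> set ?es"
    then consider i where "i \<in> {1..m}" "e = E i"
      | "e = A \<union> (\<Union>i\<in>{1..m}. B i)" | "e = A \<union> (\<Union>i\<in>{1..m}. C i)"
      unfolding set_es by blast
    then show "e \<subseteq> ?W" using BC by cases blast+
  qed
  moreover have "\<forall>e\<in>set ?es. card e \<le> r"
  proof
    fix e assume "e \<in> set ?es"
    then consider i where "i \<in> {1..m}" "e = E i"
      | "e = A \<union> (\<Union>i\<in>{1..m}. B i)" | "e = A \<union> (\<Union>i\<in>{1..m}. C i)"
      unfolding set_es by blast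
    then show "card e \<le> r"
    proof cases
      case 1
      then show ?thesis using E by simp
    next
      case 2
      then show ?thesis using card_le[of B b] BC assms(2) by (meson le_trans)
    next
      case 3
      then show ?thesis using card_le[of C c] BC assms(3) by (meson le_trans)
    qed
  qed
  ultimately obtain F where "is_uniform_extension r ?W ?es F"
    using uniform_extension_exists by blast
  then show ?thesis
    unfolding is_T_def using disj E A A3 BC
    by (intro exI[of _ F] exI[of _ E] exI[of _ A] exI[of _ B] exI[of _ C]) simp
qed

end

theory Submission
  imports Defs
begin

text \<open>Let \<open>\<alpha>\<close> be the right-hand side and let \<open>H\<close> have density above \<open>\<alpha>\<close>.  After
  deleting few edges, every set contained in an edge of \<open>H\<close> is contained in many edges, so partial
  edges can be completed by new vertices at will.  Map \<open>A\<close>, the \<open>E\<^sub>i\<close> and \<open>r - a - \<Sum>b\<^sub>i\<close> further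
  vertices into \<open>H\<close> at random, conditioned on the \<open>E\<^sub>i\<close> becoming edges.  A convexity argument shows
  that, for each choice of \<open>b\<^sub>i\<close>-subsets \<open>S\<^sub>i \<subseteq> E\<^sub>i\<close>, the union of \<open>A\<close>, the \<open>S\<^sub>i\<close> and the further
  vertices becomes an edge with probability at least the density.  Hence for some map more than
  an \<open>\<alpha>\<close>-fraction of the tuples \<open>(S\<^sub>i)\<close> is good.  By the fractional version of Hedetniemi's theorem
  for vertex-transitive graphs, a family of tuples that large contains two whose coordinates violate
  the \<open>L\<^sub>i\<close>-intersection property simultaneously for all \<open>i\<close>; inside them one finds the sets \<open>B\<^sub>i\<close>
  and \<open>C\<^sub>i\<close>.\<close>

section \<open>Independent sets in direct products of vertex-transitive graphs\<close>

text \<open>Only b_i-subsets are sampled. The sizes in [0, b_i] outside L_i are d_i, ..., b_i - c_i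
  + d_i: exactly those intersection sizes for which one of two b_i-sets contains a c_i-set meeting
  the other in d_i points. Hence a good tuple (S'_i) also serves for the sets C_i, as the cleaning
  only asks that the images of A \<union> B and A \<union> C lie inside edges. For the same reason
  the further vertices merely pad the central set to size r: their images are discarded later, and
  injectivity matters only on A and the E_i. Two obstacles remain. H need not be regular, so in a
  random edge the degrees of the parts belonging to different i may be correlated; an inequality
  linear in the reciprocals of the degrees needs only their separate averages. And a bound |X| \<le>
  \<alpha> |V| for independent sets X is not inherited by direct products of arbitrary graphs.
  Measured against closed neighbourhoods, |X| \<le> \<alpha> |N[X]|, it controls the product;
  vertex-transitivity upgrades the first form to the second and is itself inherited.\<close>

lemma sum_card_swap:
  assumes "finite S" "finite T"
  shows "(\<Sum>x\<in>S. card {y\<in>T. P x y}) = (\<Sum>y\<in>T. card {x\<in>S. P x y})"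
proof -
  have "(\<Sum>x\<in>S. card {y\<in>T. P x y}) = (\<Sum>x\<in>S. \<Sum>y\<in>T. if P x y then 1 else 0)"
    using assms by (simp add: sum.If_cases Int_def)
  also have "\<dots> = (\<Sum>y\<in>T. \<Sum>x\<in>S. if P x y then 1 else 0)"
    by (rule sum.swap)
  also have "\<dots> = (\<Sum>y\<in>T. card {x\<in>S. P x y})"
    using assms by (simp add: sum.If_cases Int_def)
  finally show ?thesis .
qed

definition indep :: "('a \<Rightarrow> 'a \<Rightarrow> bool) \<Rightarrow> 'a set \<Rightarrow> bool" where
  "indep R X \<longleftrightarrow> (\<forall>x\<in>X. \<forall>y\<in>X. \<not> R x y)"

definition closed_nbhd :: "'a set \<Rightarrow> ('a \<Rightarrow> 'a \<Rightarrow> bool) \<Rightarrow> 'a set \<Rightarrow> 'a set" where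
  "closed_nbhd V R X = X \<union> {y\<in>V. \<exists>x\<in>X. R x y}"

text \<open>Extensional functions represent each automorphism once, so there are finitely many and
  the translates of a set can be counted.\<close>

definition automorphisms :: "'a set \<Rightarrow> ('a \<Rightarrow> 'a \<Rightarrow> bool) \<Rightarrow> ('a \<Rightarrow> 'a) set" where
  "automorphisms V R =
     {s \<in> V \<rightarrow>\<^sub>E V. bij_betw s V V \<and> (\<forall>u\<in>V. \<forall>v\<in>V. R (s u) (s v) \<longleftrightarrow> R u v)}"

definition vertex_transitive :: "'a set \<Rightarrow> ('a \<Rightarrow> 'a \<Rightarrow> bool) \<Rightarrow> bool" where
  "vertex_transitive V R \<longleftrightarrow> (\<forall>x\<in>V. \<forall>y\<in>V. \<exists>s\<in>automorphisms V R. s x = y)"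

lemma restrict_in_automorphisms:
  assumes "bij_betw s V V" "\<And>u v. u \<in> V \<Longrightarrow> v \<in> V \<Longrightarrow> R (s u) (s v) \<longleftrightarrow> R u v"
  shows "restrict s V \<in> automorphisms V R"
  using assms by (auto simp: automorphisms_def dest: bij_betwE cong: bij_betw_cong)

lemma automorphisms_compose:
  assumes "s \<in> automorphisms V R" "t \<in> automorphisms V R"
  shows "compose V s t \<in> automorphisms V R"
  unfolding compose_def
proof (rule restrict_in_automorphisms)
  have "bij_betw (s \<circ> t) V V"
    using assms by (auto simp: automorphisms_def intro: bij_betw_trans)
  then show "bij_betw (\<lambda>x. s (t x)) V V" by (simp add: comp_def)
qed (use assms in \<open>auto simp: automorphisms_def dest: bij_betwE\<close>)

text \<open>The translates of a maximum independent set \<open>I\<close> cover every vertex equally often, and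
  replacing the part of a translate inside the closed neighbourhood of \<open>X\<close> by \<open>X\<close> keeps it
  independent.\<close>

lemma vertex_transitive_indep_closed_nbhd:
  assumes fin: "finite V" and sym: "symp R" and tr: "vertex_transitive V R"
    and bound: "\<And>X. X \<subseteq> V \<Longrightarrow> indep R X \<Longrightarrow> real (card X) \<le> \<alpha> * real (card V)"
    and X: "X \<subseteq> V" "indep R X"
  shows "real (card X) \<le> \<alpha> * real (card (closed_nbhd V R X))"
proof (cases "X = {}")
  case True
  then show ?thesis by (simp add: closed_nbhd_def)
next
  case False
  then obtain v0 where v0: "v0 \<in> V" using X by auto
  let ?A = "automorphisms V R"
  let ?N = "closed_nbhd V R X"
  have finA: "finite ?A"
    by (rule finite_subset[of _ "V \<rightarrow>\<^sub>E V"]) (auto simp: automorphisms_def fin finite_PiE)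
  have N: "?N \<subseteq> V" "X \<subseteq> ?N" using X by (auto simp: closed_nbhd_def)
  have finN: "finite ?N" using N fin finite_subset by blast
  let ?C = "card ` {I. I \<subseteq> V \<and> indep R I}"
  have finC: "finite ?C" using fin by simp
  have "Max ?C \<in> ?C" using finC X by (intro Max_in) auto
  then obtain I where I: "I \<subseteq> V" "indep R I" "card I = Max ?C" by auto
  have Imax: "card Y \<le> card I" if "Y \<subseteq> V" "indep R Y" for Y
    using that finC I(3) by auto
  have card_im: "card (s ` I) = card I" if "s \<in> ?A" for s
    using that I(1) by (intro card_image) (auto simp: automorphisms_def bij_betw_def intro: inj_on_subset)
  have im_sub: "s ` I \<subseteq> V" if "s \<in> ?A" for s
    using that I(1) by (auto simp: automorphisms_def)
  define c where "c y = card {s\<in>?A. y \<in> s ` I}" for y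
  \<comment> \<open>Composing with an automorphism that takes y to y' injects the translates
    covering y into those covering y'. Exchanging y and y' then gives equality.\<close>
  have c_le: "c y \<le> c y'" if "y \<in> V" "y' \<in> V" for y y'
  proof -
    obtain t where t: "t \<in> ?A" "t y = y'" using tr \<open>y \<in> V\<close> \<open>y' \<in> V\<close>
      unfolding vertex_transitive_def by blast
    show ?thesis unfolding c_def
    proof (rule card_inj_on_le[where f = "compose V t"])
      show "inj_on (compose V t) {s\<in>?A. y \<in> s ` I}"
      proof (rule inj_onI)
        fix s s' assume s: "s \<in> {s\<in>?A. y \<in> s ` I}" "s' \<in> {s\<in>?A. y \<in> s ` I}"
          and eq: "compose V t s = compose V t s'"
        have mem: "s \<in> V \<rightarrow>\<^sub>E V" "s' \<in> V \<rightarrow>\<^sub>E V" using s by (auto simp: automorphisms_def)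
        have "s x = s' x" if "x \<in> V" for x
        proof -
          have "t (s x) = t (s' x)" using fun_cong[OF eq, of x] that by (simp add: compose_def)
          moreover have "inj_on t V" using t by (simp add: automorphisms_def bij_betw_def)
          ultimately show ?thesis using mem that by (auto dest: inj_onD)
        qed
        then show "s = s'" using mem by (intro PiE_ext) auto
      qed
      show "compose V t ` {s\<in>?A. y \<in> s ` I} \<subseteq> {s\<in>?A. y' \<in> s ` I}"
      proof (rule image_subsetI)
        fix s assume "s \<in> {s\<in>?A. y \<in> s ` I}"
        then have s: "s \<in> ?A" "y \<in> s ` I" by auto
        then obtain i where i: "i \<in> I" "y = s i" by auto
        then have "y' = compose V t s i" using t I(1) by (auto simp: compose_def)
        then have "y' \<in> compose V t s ` I" using i(1) by (rule image_eqI)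
        then show "compose V t s \<in> {s\<in>?A. y' \<in> s ` I}"
          using automorphisms_compose[OF t(1) s(1)] by blast
      qed
    qed (use finA in auto)
  qed
  then have c_eq: "c y = c v0" if "y \<in> V" for y
    using v0 that by (meson le_antisym)
  \<comment> \<open>With Y = V this determines the multiplicity: c |V| = |Aut| |I|. With Y = N[X] it
    turns a bound for every single translate into |X| |V| \<le> |I| |N[X]|.\<close>
  have count: "c v0 * card Y = (\<Sum>s\<in>?A. card (s ` I \<inter> Y))" if "Y \<subseteq> V" for Y
  proof -
    have "c v0 * card Y = (\<Sum>y\<in>Y. c y)" using c_eq that by (auto simp: subset_iff)
    also have "\<dots> = (\<Sum>s\<in>?A. card {y\<in>Y. y \<in> s ` I})"
      unfolding c_def using finA that fin finite_subset by (intro sum_card_swap) auto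
    also have "\<dots> = (\<Sum>s\<in>?A. card (s ` I \<inter> Y))"
      by (intro sum.cong arg_cong[where f = card]) auto
    finally show ?thesis .
  qed
  have "c v0 * card V = (\<Sum>s\<in>?A. card I)"
    unfolding count[OF subset_refl] using card_im im_sub by (intro sum.cong) (auto simp: Int_absorb2)
  then have cV: "c v0 * card V = card ?A * card I" by simp
  have "card X \<le> card (s ` I \<inter> ?N)" if s: "s \<in> ?A" for s
  proof -
    let ?Y = "(s ` I - ?N) \<union> X"
    have "indep R ?Y"
      unfolding indep_def
    proof (intro ballI)
      fix u v assume uv: "u \<in> ?Y" "v \<in> ?Y"
      have 1: "\<not> R (s i) (s j)" if "i \<in> I" "j \<in> I" for i j
      proof -
        have "i \<in> V" "j \<in> V" using that I(1) by auto
        then show ?thesis using that I(2) s by (auto simp: automorphisms_def indep_def)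
      qed
      have 2: "\<not> R x y" "\<not> R y x" if "x \<in> X" "y \<in> s ` I - ?N" for x y
        using that im_sub[OF s] sympD[OF sym] by (auto simp: closed_nbhd_def)
      show "\<not> R u v" using uv 1 2 X(2) by (auto simp: indep_def)
    qed
    then have "card ?Y \<le> card I" using im_sub[OF s] X(1) by (intro Imax) auto
    moreover have "card ?Y = card (s ` I - ?N) + card X"
      using N X fin im_sub[OF s] by (intro card_Un_disjoint) (auto intro: finite_subset)
    moreover have "card (s ` I) = card (s ` I - ?N) + card (s ` I \<inter> ?N)"
      using card_Int_Diff[of "s ` I" ?N] finite_subset[OF im_sub[OF s] fin] by simp
    ultimately show ?thesis using card_im[OF s] by simp
  qed
  then have "card ?A * card X \<le> c v0 * card ?N"
    unfolding count[OF N(1)] using sum_bounded_below[of ?A "card X" "\<lambda>s. card (s ` I \<inter> ?N)"] by simp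
  then have "card ?A * card X * card V \<le> card ?A * card I * card ?N"
    using cV by (metis mult.assoc mult.commute mult_le_mono1)
  moreover have "card ?A > 0"
    using tr v0 finA by (auto simp: vertex_transitive_def card_gt_0_iff)
  ultimately have "card X * card V \<le> card I * card ?N" by simp
  then have "real (card X) * card V \<le> real (card I) * card ?N"
    using of_nat_mono by fastforce
  also have "\<dots> \<le> (\<alpha> * card V) * card ?N"
    using bound[OF I(1,2)] by (intro mult_right_mono) auto
  finally have "real (card X) * card V \<le> (\<alpha> * card ?N) * card V" by (simp add: mult_ac)
  moreover have "card V > 0" using v0 fin by (auto simp: card_gt_0_iff)
  ultimately show ?thesis by simp
qed

text \<open>Zhu's argument: split an independent set \<open>U\<close> of the direct product into the part \<open>P\<close> of
  points isolated in their first-coordinate fibre and the rest \<open>Q\<close>.  The fibrewise closed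
  neighbourhoods of \<open>P\<close> (in the first factor) and of \<open>Q\<close> (in the second) are disjoint.\<close>

lemma indep_direct_product_bound:
  assumes fin: "finite V" "finite V'" and sym: "symp R" "symp R'"
    and bound: "\<And>X. X \<subseteq> V \<Longrightarrow> indep R X \<Longrightarrow> real (card X) \<le> \<alpha> * real (card (closed_nbhd V R X))"
    and bound': "\<And>X. X \<subseteq> V' \<Longrightarrow> indep R' X \<Longrightarrow> real (card X) \<le> \<alpha> * real (card (closed_nbhd V' R' X))"
    and \<alpha>: "\<alpha> \<ge> 0"
    and U: "U \<subseteq> V \<times> V'" "\<And>x y x' y'. (x, y) \<in> U \<Longrightarrow> (x', y') \<in> U \<Longrightarrow> R x x' \<Longrightarrow> R' y y' \<Longrightarrow> False"
  shows "real (card U) \<le> \<alpha> * real (card V) * real (card V')"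
proof -
  define P where "P y = {x. (x, y) \<in> U \<and> (\<forall>x'. (x', y) \<in> U \<longrightarrow> \<not> R x x')}" for y
  define Q where "Q x = {y. (x, y) \<in> U \<and> (\<exists>x'. (x', y) \<in> U \<and> R x x')}" for x
  let ?N = "SIGMA y:V'. closed_nbhd V R (P y)"
  let ?N' = "SIGMA x:V. closed_nbhd V' R' (Q x)"
  have P: "P y \<subseteq> V" "indep R (P y)" for y using U(1) by (auto simp: P_def indep_def)
  \<comment> \<open>If y, y' in \<open>Q x\<close> were adjacent, a neighbour x' of x with (x', y)
    in U would make (x', y) and (x, y') an adjacent pair in U.\<close>
  have Q: "Q x \<subseteq> V'" "indep R' (Q x)" for x
    using U(1) by (fastforce simp: Q_def, use U(2) sym in \<open>fastforce simp: Q_def indep_def dest: sympD\<close>)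
  have N: "closed_nbhd V R X \<subseteq> V" if "X \<subseteq> V" for X using that by (auto simp: closed_nbhd_def)
  have N': "closed_nbhd V' R' X \<subseteq> V'" if "X \<subseteq> V'" for X using that by (auto simp: closed_nbhd_def)
  have finP: "finite (P y)" "finite (closed_nbhd V R (P y))" for y
    using P N fin finite_subset by metis+
  have finQ: "finite (Q x)" "finite (closed_nbhd V' R' (Q x))" for x
    using Q N' fin finite_subset by metis+
  have "U \<subseteq> prod.swap ` Sigma V' P \<union> Sigma V Q"
    using U(1) by (fastforce simp: P_def Q_def image_iff)
  then have "card U \<le> card (prod.swap ` Sigma V' P \<union> Sigma V Q)"
    using fin finP finQ by (intro card_mono) auto
  also have "\<dots> \<le> card (Sigma V' P) + card (Sigma V Q)"
    by (metis card_Un_le card_image inj_on_def swap_swap)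
  finally have "real (card U) \<le> (\<Sum>y\<in>V'. real (card (P y))) + (\<Sum>x\<in>V. real (card (Q x)))"
    using fin finP finQ by (simp flip: of_nat_sum of_nat_add)
  also have "\<dots> \<le> (\<Sum>y\<in>V'. \<alpha> * card (closed_nbhd V R (P y))) + (\<Sum>x\<in>V. \<alpha> * card (closed_nbhd V' R' (Q x)))"
    using bound bound' P Q by (intro add_mono sum_mono) auto
  also have "\<dots> = \<alpha> * real (card ?N + card ?N')"
    using fin finP finQ by (simp add: sum_distrib_left distrib_left)
  also have "card ?N + card ?N' = card (prod.swap ` ?N) + card ?N'"
    by (metis card_image inj_on_def swap_swap)
  also have "\<dots> = card (prod.swap ` ?N \<union> ?N')"
  proof (rule card_Un_disjoint[symmetric])
    \<comment> \<open>Let x be in or adjacent to a point u of \<open>P y\<close>, and y in or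
      adjacent to a point v of \<open>Q x\<close>. If y = v, then (u, y) is isolated in its fibre,
      against (x, y) in U when u is adjacent to x, and against the fibre neighbour of (x, y) when u
      = x. If y and v are adjacent, then (x, v) conflicts with (u, y) when u is adjacent to x; when
      u = x, a fibre neighbour of (x, v) conflicts with (x, y).\<close>
    have False if "x \<in> closed_nbhd V R (P y)" "y \<in> closed_nbhd V' R' (Q x)" for x y
      using that U(2) sympD[OF sym(1)] sympD[OF sym(2)]
      by (auto simp: closed_nbhd_def P_def Q_def) metis+
    then show "prod.swap ` ?N \<inter> ?N' = {}" by auto
  qed (use fin finP finQ in auto)
  also have "\<alpha> * real \<dots> \<le> \<alpha> * real (card (V \<times> V'))"
  proof (intro mult_left_mono[OF _ \<alpha>] of_nat_mono card_mono)
    show "prod.swap ` ?N \<union> ?N' \<subseteq> V \<times> V'" using N[OF P(1)] N'[OF Q(1)] by fastforce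
  qed (use fin in auto)
  finally show ?thesis by (simp add: card_cartesian_product)
qed

section \<open>Products of finitely many factors\<close>

lemma vertex_transitive_PiE:
  assumes "\<And>i. i \<in> I \<Longrightarrow> vertex_transitive (V i) (R i)"
  shows "vertex_transitive (PiE I V) (\<lambda>f g. \<forall>i\<in>I. R i (f i) (g i))"
  unfolding vertex_transitive_def
proof (intro ballI)
  fix f g assume fg: "f \<in> PiE I V" "g \<in> PiE I V"
  have "\<forall>i\<in>I. \<exists>s\<in>automorphisms (V i) (R i). s (f i) = g i"
    using assms fg by (auto simp: vertex_transitive_def PiE_iff)
  then obtain s where s: "\<And>i. i \<in> I \<Longrightarrow> s i \<in> automorphisms (V i) (R i)" "\<And>i. i \<in> I \<Longrightarrow> s i (f i) = g i"
    by metis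
  define t where "t h = (\<lambda>i\<in>I. s i (h i))" for h
  have bij: "bij_betw (s i) (V i) (V i)" if "i \<in> I" for i
    using s(1)[OF that] by (simp add: automorphisms_def)
  have "bij_betw t (PiE I V) (PiE I V)"
  proof (rule bij_betw_byWitness[where f' = "\<lambda>h. \<lambda>i\<in>I. inv_into (V i) (s i) (h i)"])
    show "\<forall>h\<in>PiE I V. (\<lambda>i\<in>I. inv_into (V i) (s i) (t h i)) = h"
      by (auto simp: t_def fun_eq_iff PiE_iff extensional_def bij_betw_inv_into_left[OF bij])
    show "\<forall>h\<in>PiE I V. t (\<lambda>i\<in>I. inv_into (V i) (s i) (h i)) = h"
      by (auto simp: t_def fun_eq_iff PiE_iff extensional_def bij_betw_inv_into_right[OF bij])
    show "t ` PiE I V \<subseteq> PiE I V"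
      using bij_betwE[OF bij] by (auto simp: t_def PiE_iff)
    show "(\<lambda>h. \<lambda>i\<in>I. inv_into (V i) (s i) (h i)) ` PiE I V \<subseteq> PiE I V"
      using bij_betwE[OF bij_betw_inv_into[OF bij]] by (auto simp: PiE_iff)
  qed
  moreover have "(\<forall>i\<in>I. R i (t u i) (t v i)) \<longleftrightarrow> (\<forall>i\<in>I. R i (u i) (v i))"
    if "u \<in> PiE I V" "v \<in> PiE I V" for u v
    using that s(1) by (auto simp: t_def automorphisms_def PiE_iff)
  ultimately have "restrict t (PiE I V) \<in> automorphisms (PiE I V) (\<lambda>f g. \<forall>i\<in>I. R i (f i) (g i))"
    by (intro restrict_in_automorphisms) auto
  moreover have "t f = g" using fg(2) s(2) by (intro ext) (auto simp: t_def PiE_iff extensional_def)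
  ultimately show "\<exists>s\<in>automorphisms (PiE I V) (\<lambda>f g. \<forall>i\<in>I. R i (f i) (g i)). s f = g"
    using fg(1) by (intro bexI[of _ "restrict t (PiE I V)"]) simp_all
qed

text \<open>Induction on the index set, splitting off one factor. The remaining product is again
  vertex-transitive, so the induction hypothesis for it can be upgraded to the closed-neighbourhood
  bound that the two-factor argument requires.\<close>

lemma indep_PiE_bound:
  fixes V :: "'i \<Rightarrow> 'a set"
  assumes "finite I" "\<alpha> \<ge> 0"
    and "\<And>i. i \<in> I \<Longrightarrow> finite (V i)" "\<And>i. i \<in> I \<Longrightarrow> symp (R i)"
    and "\<And>i. i \<in> I \<Longrightarrow> vertex_transitive (V i) (R i)"
    and "\<And>i X. i \<in> I \<Longrightarrow> X \<subseteq> V i \<Longrightarrow> indep (R i) X \<Longrightarrow> real (card X) \<le> \<alpha> * real (card (V i))"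
    and "U \<subseteq> PiE I V" "indep (\<lambda>f g. \<forall>i\<in>I. R i (f i) (g i)) U"
  shows "real (card U) \<le> \<alpha> * real (card (PiE I V))"
  using assms
proof (induction I arbitrary: U rule: finite_induct)
  case empty
  \<comment> \<open>Over no indices the product relation holds for every pair, even for a point and
    itself, so no point lies in an independent set.\<close>
  then have "U = {}" by (auto simp: indep_def)
  with \<open>\<alpha> \<ge> 0\<close> show ?case by simp
next
  case (insert j I)
  define U' where "U' = {(x, f) \<in> V j \<times> PiE I V. f(j := x) \<in> U}"
  let ?R = "\<lambda>f g. \<forall>i\<in>I. R i (f i) (g i)"
  have "U = (\<lambda>(x, f). f(j := x)) ` U'"
  proof
    show "U \<subseteq> (\<lambda>(x, f). f(j := x)) ` U'"
    proof
      fix h assume h: "h \<in> U"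
      with insert.prems have "h \<in> PiE (insert j I) V" by auto
      then obtain x f where "x \<in> V j" "f \<in> PiE I V" "h = f(j := x)" by (auto simp: PiE_insert_eq)
      with h show "h \<in> (\<lambda>(x, f). f(j := x)) ` U'"
        by (auto simp: U'_def intro!: image_eqI[where x = "(x, f)"])
    qed
  qed (auto simp: U'_def)
  moreover have "finite U'"
  proof (rule finite_subset)
    show "U' \<subseteq> V j \<times> PiE I V" by (auto simp: U'_def)
    show "finite (V j \<times> PiE I V)" using insert by (intro finite_cartesian_product finite_PiE) auto
  qed
  ultimately have "card U \<le> card U'" by (metis card_image_le)
  also have "real (card U') \<le> \<alpha> * real (card (V j)) * real (card (PiE I V))"
  proof (rule indep_direct_product_bound[where R = "R j" and R' = ?R])
    show "finite (PiE I V)" using insert by (intro finite_PiE) auto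
    show "symp ?R" using insert.prems(3) unfolding symp_def by blast
    show "U' \<subseteq> V j \<times> PiE I V" by (auto simp: U'_def)
    show "real (card X) \<le> \<alpha> * real (card (closed_nbhd (V j) (R j) X))" if "X \<subseteq> V j" "indep (R j) X" for X
      using that insert.prems by (intro vertex_transitive_indep_closed_nbhd) auto
    show "real (card X) \<le> \<alpha> * real (card (closed_nbhd (PiE I V) ?R X))" if "X \<subseteq> PiE I V" "indep ?R X" for X
      using that insert.prems \<open>finite (PiE I V)\<close> \<open>symp ?R\<close>
      by (intro vertex_transitive_indep_closed_nbhd vertex_transitive_PiE insert.IH) auto
    show False if "(x, y) \<in> U'" "(x', y') \<in> U'" "R j x x'" "?R y y'" for x y x' y'
    proof -
      have "\<forall>i\<in>insert j I. R i ((y(j := x)) i) ((y'(j := x')) i)"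
        using that insert.hyps by auto
      moreover have "y(j := x) \<in> U" "y'(j := x') \<in> U" using that by (auto simp: U'_def)
      ultimately show False using insert.prems(7) unfolding indep_def by blast
    qed
  qed (use insert.prems in auto)
  finally show ?case using insert.hyps by (simp add: card_PiE mult_ac)
qed

section \<open>Set families with forbidden intersection sizes\<close>

text \<open>Two subsets cut \<open>E\<close> into four cells, and the three cardinalities together
  with that of \<open>E\<close> determine the sizes of all four. Bijections between corresponding
  cells are glued together.\<close>

lemma bij_betw_matching_two_subsets:
  assumes fin: "finite E" and sub: "B \<subseteq> E" "C \<subseteq> E" "B' \<subseteq> E" "C' \<subseteq> E"
    and card: "card B = card B'" "card C = card C'" "card (B \<inter> C) = card (B' \<inter> C')"
  obtains p where "bij_betw p E E" "p ` B = B'" "p ` C = C'"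
proof -
  have f: "finite B" "finite C" "finite B'" "finite C'" using fin sub finite_subset by metis+
  have c: "card (B - C) = card (B' - C')" "card (C - B) = card (C' - B')"
    using card f by (simp_all add: card_Diff_subset_Int Int_commute)
  have "card (B \<union> C) = card (B' \<union> C')"
    using card f by (metis card_Un_Int add_right_cancel)
  then have c': "card (E - (B \<union> C)) = card (E - (B' \<union> C'))"
    using sub f by (simp add: card_Diff_subset)
  obtain p1 p2 p3 p4 where p: "bij_betw p1 (B \<inter> C) (B' \<inter> C')" "bij_betw p2 (B - C) (B' - C')"
      "bij_betw p3 (C - B) (C' - B')" "bij_betw p4 (E - (B \<union> C)) (E - (B' \<union> C'))"
    using finite_same_card_bij f fin card(3) c c' by (metis finite_Diff finite_Int)
  define p where "p x = (if x \<in> B \<inter> C then p1 x else if x \<in> B then p2 x else if x \<in> C then p3 x else p4 x)" for x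
  have "p ` (B \<inter> C) = p1 ` (B \<inter> C)" "p ` (B - C) = p2 ` (B - C)" "p ` (C - B) = p3 ` (C - B)"
      "p ` (E - (B \<union> C)) = p4 ` (E - (B \<union> C))"
    by (intro image_cong; simp add: p_def)+
  then have im: "p ` (B \<inter> C) = B' \<inter> C'" "p ` (B - C) = B' - C'" "p ` (C - B) = C' - B'"
      "p ` (E - (B \<union> C)) = E - (B' \<union> C')"
    using p by (simp_all add: bij_betw_def)
  have "p ` B = p ` (B \<inter> C) \<union> p ` (B - C)" by blast
  then have B: "p ` B = B'" unfolding im by blast
  have "p ` C = p ` (B \<inter> C) \<union> p ` (C - B)" by blast
  then have C: "p ` C = C'" unfolding im by blast
  have "p ` E = p ` B \<union> p ` C \<union> p ` (E - (B \<union> C))" using sub by blast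
  then have E: "p ` E = E" unfolding im B C using sub by blast
  have "inj_on p E" using fin E by (intro finite_surj_inj) auto
  then show thesis using that[of p] B C E by (simp add: bij_betw_def)
qed

lemma card_le_Psi:
  assumes X: "finite X" "card X = r"
    and F: "\<F> \<subseteq> {B. B \<subseteq> X \<and> card B = b}" "L_intersecting L \<F>"
  shows "card \<F> \<le> Psi r b L"
proof -
  obtain g where g: "bij_betw g X {1..r}"
    using X by (metis card_atLeastAtMost diff_Suc_1 finite_atLeastAtMost finite_same_card_bij)
  then have inj: "inj_on g X" and im: "g ` X = {1..r}" by (auto simp: bij_betw_def)
  have "(`) g ` \<F> \<subseteq> {B. B \<subseteq> {1..r} \<and> card B = b}"
  proof (rule image_subsetI)
    fix B assume "B \<in> \<F>"
    then have B: "B \<subseteq> X" "card B = b" using F(1) by auto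
    have "g ` B \<subseteq> {1..r}" using B(1) im by blast
    then show "g ` B \<in> {B. B \<subseteq> {1..r} \<and> card B = b}"
      using B card_image[OF inj_on_subset[OF inj B(1)]] by simp
  qed
  moreover have "L_intersecting L ((`) g ` \<F>)"
    unfolding L_intersecting_def
  proof clarify
    fix B B' assume B: "B \<in> \<F>" "B' \<in> \<F>" "g ` B \<noteq> g ` B'"
    then have "B \<subseteq> X" "B' \<subseteq> X" using F(1) by auto
    then have "card (g ` B \<inter> g ` B') = card (B \<inter> B')"
      using inj_on_image_Int[OF inj] card_image[OF inj_on_subset[OF inj]] by (metis le_infI1)
    then show "card (g ` B \<inter> g ` B') \<in> L" using B F(2) by (auto simp: L_intersecting_def)
  qed
  moreover have "card ((`) g ` \<F>) = card \<F>"
    using F(1) by (intro card_image inj_on_subset[OF inj_on_image_Pow[OF inj]]) auto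
  moreover have "finite {card \<B> | \<B>. \<B> \<subseteq> {B. B \<subseteq> {1..r} \<and> card B = b} \<and> L_intersecting L \<B>}"
    by (rule finite_subset[of _ "card ` Pow (Pow {1..r})"]) auto
  ultimately show ?thesis unfolding Psi_def
    by (intro Max_ge CollectI exI[of _ "(`) g ` \<F>"] conjI) simp_all
qed

text \<open>The graph whose independent sets are the L-intersecting families. Demanding distinct
  sets keeps it loopless also when b is not in L, as happens for d_i = c_i.\<close>

definition conflict :: "nat set \<Rightarrow> 'a set \<Rightarrow> 'a set \<Rightarrow> bool" where
  "conflict L B B' \<longleftrightarrow> B \<noteq> B' \<and> card (B \<inter> B') \<notin> L"

lemma symp_conflict: "symp (conflict L)"
  by (auto simp: symp_def conflict_def Int_commute)

lemma indep_conflict_iff: "indep (conflict L) \<F> \<longleftrightarrow> L_intersecting L \<F>"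
  by (auto simp: indep_def conflict_def L_intersecting_def)

text \<open>Permutations of X preserve intersection sizes, and they act transitively on the subsets
  of a given size: this is the matching of two subsets with the second one empty.\<close>

lemma vertex_transitive_conflict:
  assumes "finite X"
  shows "vertex_transitive {B. B \<subseteq> X \<and> card B = b} (conflict L)"
  unfolding vertex_transitive_def
proof (intro ballI)
  let ?V = "{B. B \<subseteq> X \<and> card B = b}"
  fix B B' assume B: "B \<in> ?V" "B' \<in> ?V"
  then obtain p where p: "bij_betw p X X" "p ` B = B'"
    using bij_betw_matching_two_subsets[OF assms, of B "{}" B' "{}"] by auto
  then have inj: "inj_on p X" and im: "p ` X = X" by (auto simp: bij_betw_def)
  have card: "card (p ` C) = card C" if "C \<subseteq> X" for C
    using that inj by (meson card_image inj_on_subset)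
  have injV: "inj_on ((`) p) ?V"
    by (intro inj_on_subset[OF inj_on_image_Pow[OF inj]]) auto
  have sub: "(`) p ` ?V \<subseteq> ?V"
  proof (rule image_subsetI)
    fix C assume "C \<in> ?V"
    then have C: "C \<subseteq> X" "card C = b" by auto
    then show "p ` C \<in> ?V" using card[OF C(1)] im by blast
  qed
  have "finite ?V" using assms by simp
  then have bij: "bij_betw ((`) p) ?V ?V"
    by (intro bij_betw_imageI injV endo_inj_surj sub)
  have "conflict L (p ` C) (p ` D) \<longleftrightarrow> conflict L C D" if CD: "C \<in> ?V" "D \<in> ?V" for C D
  proof -
    have "p ` C \<inter> p ` D = p ` (C \<inter> D)" using CD inj_on_image_Int[OF inj] by auto
    moreover have "p ` C = p ` D \<longleftrightarrow> C = D" using CD injV by (meson inj_onD)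
    moreover have "C \<inter> D \<subseteq> X" using CD by auto
    ultimately show ?thesis using card[of "C \<inter> D"] by (simp add: conflict_def)
  qed
  with bij have "restrict ((`) p) ?V \<in> automorphisms ?V (conflict L)"
    by (rule restrict_in_automorphisms)
  then show "\<exists>s\<in>automorphisms ?V (conflict L). s B = B'"
    using B p by (intro bexI[of _ "restrict ((`) p) ?V"]) simp_all
qed

section \<open>Counting homomorphisms of an edge with pendant edges\<close>

text \<open>A labelled degree: if |S| + |D| = r and all edges have r elements, each edge through S
  is counted once for each of the |D|! ways to label its other vertices by D. Counting maps instead
  of edges makes the sums over maps below factorize.\<close>

definition ext_count :: "'v set \<Rightarrow> 'v set set \<Rightarrow> 'j set \<Rightarrow> 'v set \<Rightarrow> nat" where
  "ext_count V H D S = card {\<psi> \<in> D \<rightarrow>\<^sub>E V. S \<union> \<psi> ` D \<in> H}"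

lemma ext_count_le:
  assumes "finite V" "finite D" "finite D'" "card D = card D'"
  shows "ext_count V H D S \<le> ext_count V H D' S"
proof -
  obtain p where p: "bij_betw p D' D" using assms finite_same_card_bij by metis
  have im: "(\<lambda>x\<in>D'. \<psi> (p x)) ` D' = \<psi> ` D" for \<psi>
    using p by (auto simp: bij_betw_def)
  show ?thesis unfolding ext_count_def
  proof (rule card_inj_on_le[where f = "\<lambda>\<psi>. \<lambda>x\<in>D'. \<psi> (p x)"])
    show "inj_on (\<lambda>\<psi>. \<lambda>x\<in>D'. \<psi> (p x)) {\<psi> \<in> D \<rightarrow>\<^sub>E V. S \<union> \<psi> ` D \<in> H}"
    proof (rule inj_onI)
      fix \<psi> \<psi>' assume mem: "\<psi> \<in> {\<psi> \<in> D \<rightarrow>\<^sub>E V. S \<union> \<psi> ` D \<in> H}" "\<psi>' \<in> {\<psi> \<in> D \<rightarrow>\<^sub>E V. S \<union> \<psi> ` D \<in> H}"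
        and eq: "(\<lambda>x\<in>D'. \<psi> (p x)) = (\<lambda>x\<in>D'. \<psi>' (p x))"
      have "\<psi> y = \<psi>' y" if "y \<in> D" for y
      proof -
        obtain x where "x \<in> D'" "y = p x" using p \<open>y \<in> D\<close> by (auto simp: bij_betw_def)
        then show ?thesis using fun_cong[OF eq, of x] by simp
      qed
      then show "\<psi> = \<psi>'" using mem by (auto intro: PiE_ext)
    qed
    show "(\<lambda>\<psi>. \<lambda>x\<in>D'. \<psi> (p x)) ` {\<psi> \<in> D \<rightarrow>\<^sub>E V. S \<union> \<psi> ` D \<in> H} \<subseteq> {\<psi> \<in> D' \<rightarrow>\<^sub>E V. S \<union> \<psi> ` D' \<in> H}"
    proof (rule image_subsetI)
      fix \<psi> assume "\<psi> \<in> {\<psi> \<in> D \<rightarrow>\<^sub>E V. S \<union> \<psi> ` D \<in> H}"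
      moreover have "p x \<in> D" if "x \<in> D'" for x using p that by (rule bij_betw_apply)
      ultimately show "(\<lambda>x\<in>D'. \<psi> (p x)) \<in> {\<psi> \<in> D' \<rightarrow>\<^sub>E V. S \<union> \<psi> ` D' \<in> H}"
        unfolding mem_Collect_eq im by auto
    qed
    show "finite {\<psi> \<in> D' \<rightarrow>\<^sub>E V. S \<union> \<psi> ` D' \<in> H}"
      using assms by (simp add: finite_PiE)
  qed
qed

lemma ext_count_cong:
  assumes "finite V" "finite D" "finite D'" "card D = card D'"
  shows "ext_count V H D S = ext_count V H D' S"
  using assms by (intro antisym ext_count_le) auto

lemma ext_count_empty:
  assumes V: "finite V" and H: "\<And>e. e \<in> H \<Longrightarrow> e \<subseteq> V \<and> card e = r" and D: "finite D" "card D = r"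
  shows "ext_count V H D {} = fact r * card H"
proof -
  let ?A = "\<lambda>e. {\<psi> \<in> D \<rightarrow>\<^sub>E V. \<psi> ` D = e}"
  have "{\<psi> \<in> D \<rightarrow>\<^sub>E V. {} \<union> \<psi> ` D \<in> H} = (\<Union>e\<in>H. ?A e)" by auto
  moreover have "card (\<Union>e\<in>H. ?A e) = (\<Sum>e\<in>H. card (?A e))"
  proof (rule card_UN_disjoint)
    show "finite H" by (rule finite_subset[of _ "Pow V"]) (use H V in auto)
    show "\<forall>e\<in>H. finite (?A e)" using V D by (simp add: finite_PiE)
  qed auto
  moreover have "card (?A e) = fact r" if e: "e \<in> H" for e
  proof -
    have fe: "finite e" "card e = r" "e \<subseteq> V" using H[OF e] V finite_subset by auto
    have "?A e = {\<psi> \<in> D \<rightarrow>\<^sub>E e. inj_on \<psi> D}"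
    proof (intro equalityI subsetI)
      fix \<psi> assume "\<psi> \<in> ?A e"
      then show "\<psi> \<in> {\<psi> \<in> D \<rightarrow>\<^sub>E e. inj_on \<psi> D}"
        using fe D by (auto intro: eq_card_imp_inj_on)
    next
      fix \<psi> assume \<psi>: "\<psi> \<in> {\<psi> \<in> D \<rightarrow>\<^sub>E e. inj_on \<psi> D}"
      then have "\<psi> ` D \<subseteq> e" "card (\<psi> ` D) = card e" using fe D by (auto simp: card_image)
      then have "\<psi> ` D = e" using fe(1) by (intro card_subset_eq)
      then show "\<psi> \<in> ?A e" using \<psi> fe by auto
    qed
    also have "card \<dots> = fact r"
      using card_inj_on_subset_funcset[of D e D] D fe by (simp add: fact_prod_rev)
    finally show ?thesis .
  qed
  ultimately show ?thesis by (simp add: ext_count_def)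
qed

lemma sum_PiE_Un_disjoint:
  assumes "J \<inter> D = {}"
  shows "(\<Sum>\<phi>\<in>(J \<union> D) \<rightarrow>\<^sub>E V. f (restrict \<phi> J) (restrict \<phi> D)) = (\<Sum>\<phi>\<in>J \<rightarrow>\<^sub>E V. \<Sum>\<psi>\<in>D \<rightarrow>\<^sub>E V. f \<phi> \<psi>)"
proof -
  have "(\<Sum>\<phi>\<in>(J \<union> D) \<rightarrow>\<^sub>E V. f (restrict \<phi> J) (restrict \<phi> D)) = (\<Sum>(\<phi>, \<psi>)\<in>(J \<rightarrow>\<^sub>E V) \<times> (D \<rightarrow>\<^sub>E V). f \<phi> \<psi>)"
  proof (rule sum.reindex_bij_witness[where j = "\<lambda>\<phi>. (restrict \<phi> J, restrict \<phi> D)"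
        and i = "\<lambda>(\<phi>, \<psi>). \<lambda>x\<in>J \<union> D. if x \<in> J then \<phi> x else \<psi> x"])
    fix \<phi> assume "\<phi> \<in> (J \<union> D) \<rightarrow>\<^sub>E V"
    then show "(case (restrict \<phi> J, restrict \<phi> D) of (\<phi>, \<psi>) \<Rightarrow> \<lambda>x\<in>J \<union> D. if x \<in> J then \<phi> x else \<psi> x) = \<phi>"
      by (intro ext) (auto simp: PiE_iff extensional_def)
  next
    fix p assume "p \<in> (J \<rightarrow>\<^sub>E V) \<times> (D \<rightarrow>\<^sub>E V)"
    then obtain \<phi> \<psi> where p: "p = (\<phi>, \<psi>)" "\<phi> \<in> J \<rightarrow>\<^sub>E V" "\<psi> \<in> D \<rightarrow>\<^sub>E V" by auto
    let ?m = "\<lambda>x\<in>J \<union> D. if x \<in> J then \<phi> x else \<psi> x"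
    have "restrict ?m J = \<phi>" using p(2) by (intro ext) (auto simp: PiE_iff extensional_def)
    moreover have "restrict ?m D = \<psi>" using p(3) assms by (intro ext) (auto simp: PiE_iff extensional_def)
    ultimately show "(restrict (case p of (\<phi>, \<psi>) \<Rightarrow> \<lambda>x\<in>J \<union> D. if x \<in> J then \<phi> x else \<psi> x) J,
         restrict (case p of (\<phi>, \<psi>) \<Rightarrow> \<lambda>x\<in>J \<union> D. if x \<in> J then \<phi> x else \<psi> x) D) = p"
      using p by simp
    show "(case p of (\<phi>, \<psi>) \<Rightarrow> \<lambda>x\<in>J \<union> D. if x \<in> J then \<phi> x else \<psi> x) \<in> (J \<union> D) \<rightarrow>\<^sub>E V"
      using p by auto
  qed auto
  then show ?thesis by (simp add: sum.cartesian_product)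
qed

lemma sum_of_bool_ext_count:
  assumes "finite V" "finite D"
  shows "(\<Sum>\<psi>\<in>D \<rightarrow>\<^sub>E V. of_bool (S \<union> \<psi> ` D \<in> H)) = real (ext_count V H D S)"
  using assms by (simp add: ext_count_def finite_PiE Int_def)

text \<open>Once the values on \<open>K\<close> are fixed, the sets \<open>E i - K\<close> are
  disjoint and are mapped independently of each other. The weight is arbitrary because the induction
  absorbs the degree belonging to the removed \<open>E j\<close> into it.\<close>

lemma sum_pendant_edges:
  fixes w :: "('j \<Rightarrow> 'v) \<Rightarrow> real"
  assumes "finite I" "finite V" "finite K" "\<And>i. i \<in> I \<Longrightarrow> finite (E i)" "disjoint_family_on E I"
  shows "(\<Sum>\<phi>\<in>(K \<union> (\<Union>i\<in>I. E i)) \<rightarrow>\<^sub>E V. w (restrict \<phi> K) * (\<Prod>i\<in>I. of_bool (\<phi> ` E i \<in> H)))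
    = (\<Sum>g\<in>K \<rightarrow>\<^sub>E V. w g * (\<Prod>i\<in>I. real (ext_count V H (E i - K) (g ` (E i \<inter> K)))))"
  using assms
proof (induction I arbitrary: w rule: finite_induct)
  case empty
  have "(\<Sum>\<phi>\<in>K \<rightarrow>\<^sub>E V. w (restrict \<phi> K)) = (\<Sum>g\<in>K \<rightarrow>\<^sub>E V. w g)"
    by (intro sum.cong) (simp_all add: PiE_restrict)
  then show ?case by simp
next
  case (insert j I)
  let ?J = "K \<union> (\<Union>i\<in>I. E i)"
  let ?D = "E j - K"
  have "E j \<inter> E i = {}" if "i \<in> I" for i
    using insert.prems(4) insert.hyps that by (auto simp: disjoint_family_on_def)
  then have JD: "?J \<inter> ?D = {}" and EJ: "E j \<inter> ?J = E j \<inter> K" by blast+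
  define F where "F \<phi> \<psi> = w (restrict \<phi> K) * (\<Prod>i\<in>I. of_bool (\<phi> ` E i \<in> H)) *
      (of_bool (\<phi> ` (E j \<inter> K) \<union> \<psi> ` ?D \<in> H) :: real)" for \<phi> \<psi>
  have eq: "w (restrict \<phi> K) * (\<Prod>i\<in>insert j I. of_bool (\<phi> ` E i \<in> H))
      = F (restrict \<phi> ?J) (restrict \<phi> ?D)" for \<phi>
  proof -
    have "restrict (restrict \<phi> ?J) K = restrict \<phi> K" by (auto simp: fun_eq_iff)
    moreover have "restrict \<phi> ?J ` E i = \<phi> ` E i" if "i \<in> I" for i
      using that by (intro image_cong) auto
    moreover have "restrict \<phi> ?J ` (E j \<inter> K) \<union> restrict \<phi> ?D ` ?D = \<phi> ` E j"
    proof -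
      have "restrict \<phi> ?J ` (E j \<inter> K) = \<phi> ` (E j \<inter> K)" "restrict \<phi> ?D ` ?D = \<phi> ` ?D"
        by (intro image_cong; simp)+
      then show ?thesis by (metis Int_Diff_Un image_Un)
    qed
    ultimately show ?thesis using insert.hyps by (simp add: F_def mult_ac)
  qed
  have "(\<Sum>\<phi>\<in>(K \<union> (\<Union>i\<in>insert j I. E i)) \<rightarrow>\<^sub>E V. w (restrict \<phi> K) * (\<Prod>i\<in>insert j I. of_bool (\<phi> ` E i \<in> H)))
      = (\<Sum>\<phi>\<in>(?J \<union> ?D) \<rightarrow>\<^sub>E V. F (restrict \<phi> ?J) (restrict \<phi> ?D))"
  proof -
    have "K \<union> (\<Union>i\<in>insert j I. E i) = ?J \<union> ?D" by auto
    then show ?thesis unfolding eq by simp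
  qed
  also have "\<dots> = (\<Sum>\<phi>\<in>?J \<rightarrow>\<^sub>E V. \<Sum>\<psi>\<in>?D \<rightarrow>\<^sub>E V. F \<phi> \<psi>)"
    by (rule sum_PiE_Un_disjoint[OF JD])
  also have "\<dots> = (\<Sum>\<phi>\<in>?J \<rightarrow>\<^sub>E V. (w (restrict \<phi> K) * real (ext_count V H ?D (restrict \<phi> K ` (E j \<inter> K))))
      * (\<Prod>i\<in>I. of_bool (\<phi> ` E i \<in> H)))"
  proof (rule sum.cong[OF refl])
    fix \<phi> :: "'j \<Rightarrow> 'v"
    have "restrict \<phi> K ` (E j \<inter> K) = \<phi> ` (E j \<inter> K)" by (intro image_cong) auto
    then show "(\<Sum>\<psi>\<in>?D \<rightarrow>\<^sub>E V. F \<phi> \<psi>) = (w (restrict \<phi> K) * real (ext_count V H ?D (restrict \<phi> K ` (E j \<inter> K))))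
      * (\<Prod>i\<in>I. of_bool (\<phi> ` E i \<in> H))"
      using insert.prems sum_of_bool_ext_count[of V ?D "\<phi> ` (E j \<inter> K)" H]
      by (simp only: F_def flip: sum_distrib_left) simp
  qed
  also have "\<dots> = (\<Sum>g\<in>K \<rightarrow>\<^sub>E V. (w g * real (ext_count V H ?D (g ` (E j \<inter> K)))) *
      (\<Prod>i\<in>I. real (ext_count V H (E i - K) (g ` (E i \<inter> K)))))"
    using insert.prems by (intro insert.IH) (auto intro: disjoint_family_on_mono[of I "insert j I"])
  finally show ?case by (simp only: prod.insert[OF insert.hyps] mult.assoc)
qed

text \<open>Since 1 - 1/t \<le> ln t, the sum is at most the logarithm of the product, and 1 + x
  \<le> exp x leads back to the product.\<close>

lemma prod_ge_one_plus_sum: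
  fixes t :: "'i \<Rightarrow> real"
  assumes "\<And>i. i \<in> I \<Longrightarrow> t i > 0"
  shows "(\<Prod>i\<in>I. t i) \<ge> 1 + (\<Sum>i\<in>I. 1 - 1 / t i)"
proof (cases "finite I")
  case True
  have "1 - 1 / t i \<le> ln (t i)" if "i \<in> I" for i
    using ln_le_minus_one[of "1 / t i"] assms[OF that] by (simp add: ln_div)
  then have "1 + (\<Sum>i\<in>I. 1 - 1 / t i) \<le> 1 + (\<Sum>i\<in>I. ln (t i))"
    by (simp add: sum_mono)
  also have "\<dots> \<le> exp (\<Sum>i\<in>I. ln (t i))" by (rule exp_ge_add_one_self)
  also have "\<dots> = (\<Prod>i\<in>I. t i)" using True assms by (simp add: exp_sum)
  finally show ?thesis .
qed simp

text \<open>Given a copy \<open>g\<close> of the central edge, the numbers \<open>t\<^sub>i\<close> compare the degree of its part in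
  \<open>E\<^sub>i\<close> with the average degree.  The harmonic means of these degrees over all copies
  are at least the averages, which suffices because a product of \<open>t\<^sub>i\<close> dominates
  \<open>1 + \<Sum>(1 - 1/t\<^sub>i)\<close>.\<close>

lemma hom_count_lower_bound:
  fixes E :: "'i \<Rightarrow> 'j set" and V :: "'v set"
  assumes I: "finite I" and V: "finite V" "V \<noteq> {}"
    and H: "\<And>e. e \<in> H \<Longrightarrow> e \<subseteq> V \<and> card e = r"
    and K: "finite K" "card K = r"
    and E: "\<And>i. i \<in> I \<Longrightarrow> finite (E i) \<and> card (E i) = r" "disjoint_family_on E I"
  shows "real (fact r * card H) * (\<Prod>i\<in>I. real (fact r * card H) / real (card V) ^ card (E i \<inter> K))
    \<le> real (card {\<phi> \<in> (K \<union> (\<Union>i\<in>I. E i)) \<rightarrow>\<^sub>E V. \<phi> ` K \<in> H \<and> (\<forall>i\<in>I. \<phi> ` E i \<in> H)})"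
proof (cases "H = {}")
  case True
  then show ?thesis by simp
next
  case False
  define q where "q = real (fact r * card H)"
  define G where "G = {g \<in> K \<rightarrow>\<^sub>E V. g ` K \<in> H}"
  define deg where "deg i g = real (ext_count V H (E i - K) (g ` (E i \<inter> K)))" for i and g :: "'j \<Rightarrow> 'v"
  \<comment> \<open>The average degree over all maps of \<open>E i \<inter> K\<close> into V: the
    degrees of these maps add up to q, the number of maps of \<open>E i\<close> onto edges.\<close>
  define D where "D i = q / real (card V) ^ card (E i \<inter> K)" for i
  have finH: "finite H" by (rule finite_subset[of _ "Pow V"]) (use H V in auto)
  have q: "q > 0" using False finH by (simp add: q_def card_gt_0_iff)
  have n: "real (card V) > 0" using V by (simp add: card_gt_0_iff)
  have D: "D i > 0" for i using q n by (simp add: D_def)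
  have finG: "finite G" using K V by (simp add: G_def finite_PiE)
  have cardG: "real (card G) = q"
    using ext_count_empty[OF V(1) H K] by (simp add: q_def G_def ext_count_def)
  have cards: "card (E i - K) = card (K - E i)" if "i \<in> I" for i
    using E(1)[OF that] K by (simp add: card_Diff_subset_Int Int_commute)
  \<comment> \<open>The rest of \<open>g\<close> is itself a completion. It lives on
    \<open>K - E i\<close> rather than \<open>E i - K\<close>, but these have equal size because
    both \<open>K\<close> and \<open>E i\<close> have r elements.\<close>
  have degpos: "deg i g > 0" if i: "i \<in> I" and g: "g \<in> G" for i g
  proof -
    have "ext_count V H (E i - K) (g ` (E i \<inter> K)) = ext_count V H (K - E i) (g ` (E i \<inter> K))"
      using V E(1)[OF i] K cards[OF i] by (intro ext_count_cong) auto
    moreover have "restrict g (K - E i) \<in> {\<psi> \<in> (K - E i) \<rightarrow>\<^sub>E V. g ` (E i \<inter> K) \<union> \<psi> ` (K - E i) \<in> H}"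
    proof -
      have "restrict g (K - E i) ` (K - E i) = g ` (K - E i)" by (intro image_cong) auto
      then have "g ` (E i \<inter> K) \<union> restrict g (K - E i) ` (K - E i) = g ` K"
        by (metis Int_Diff_Un Int_commute image_Un)
      then show ?thesis using g by (auto simp: G_def)
    qed
    moreover have "finite {\<psi> \<in> (K - E i) \<rightarrow>\<^sub>E V. g ` (E i \<inter> K) \<union> \<psi> ` (K - E i) \<in> H}"
      using V K by (simp add: finite_PiE)
    ultimately have "ext_count V H (E i - K) (g ` (E i \<inter> K)) > 0"
      unfolding ext_count_def by (metis (no_types, lifting) card_gt_0_iff empty_iff)
    then show ?thesis by (simp add: deg_def)
  qed
  \<comment> \<open>Group the copies g by their restriction z to \<open>E i \<inter> K\<close>. The
    number of copies over z is the degree of z itself, so each z contributes 1, or 0 if its degree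
    is 0, where division by zero gives 0. Multiplying by \<open>D i\<close> turns the number of all
    z into q.\<close>
  have harm: "(\<Sum>g\<in>G. 1 / (deg i g / D i)) \<le> q" if i: "i \<in> I" for i
  proof -
    let ?B = "E i \<inter> K" and ?K = "K - E i"
    define f where "f z \<psi> = of_bool (z ` ?B \<union> \<psi> ` ?K \<in> H) * (1 / deg i z)" for z \<psi> :: "'j \<Rightarrow> 'v"
    have K': "?B \<union> ?K = K" "?B \<inter> ?K = {}" by auto
    have finB: "finite ?B" "finite ?K" using K by auto
    have "(\<Sum>g\<in>G. 1 / deg i g) = (\<Sum>g\<in>K \<rightarrow>\<^sub>E V. if g ` K \<in> H then 1 / deg i g else 0)"
      unfolding G_def using K V by (intro sum.inter_filter) (simp add: finite_PiE)
    also have "\<dots> = (\<Sum>g\<in>(?B \<union> ?K) \<rightarrow>\<^sub>E V. f (restrict g ?B) (restrict g ?K))"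
      unfolding K'
    proof (rule sum.cong[OF refl])
      fix g :: "'j \<Rightarrow> 'v"
      have im: "restrict g ?B ` ?B = g ` ?B" "restrict g ?K ` ?K = g ` ?K" by (intro image_cong; simp)+
      then have "restrict g ?B ` ?B \<union> restrict g ?K ` ?K = g ` K"
        by (metis K'(1) image_Un)
      then show "(if g ` K \<in> H then 1 / deg i g else 0) = f (restrict g ?B) (restrict g ?K)"
        by (simp add: f_def deg_def im(1))
    qed
    also have "\<dots> = (\<Sum>z\<in>?B \<rightarrow>\<^sub>E V. \<Sum>\<psi>\<in>?K \<rightarrow>\<^sub>E V. f z \<psi>)"
      by (rule sum_PiE_Un_disjoint[OF K'(2)])
    also have "\<dots> \<le> (\<Sum>z\<in>?B \<rightarrow>\<^sub>E V. 1)"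
    proof (rule sum_mono)
      fix z
      have "(\<Sum>\<psi>\<in>?K \<rightarrow>\<^sub>E V. f z \<psi>) = real (ext_count V H ?K (z ` ?B)) / deg i z"
        unfolding f_def sum_distrib_right[symmetric] sum_of_bool_ext_count[OF V(1) finB(2)] by simp
      also have "ext_count V H ?K (z ` ?B) = ext_count V H (E i - K) (z ` ?B)"
        using V E(1)[OF i] K cards[OF i] by (intro ext_count_cong) auto
      finally show "(\<Sum>\<psi>\<in>?K \<rightarrow>\<^sub>E V. f z \<psi>) \<le> 1" by (simp add: deg_def)
    qed
    also have "\<dots> = real (card V) ^ card ?B" using finB by (simp add: card_funcsetE)
    finally have "D i * (\<Sum>g\<in>G. 1 / deg i g) \<le> D i * real (card V) ^ card ?B"
      using D[of i] by simp
    then show ?thesis using n by (simp add: sum_distrib_left) (simp add: D_def)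
  qed
  \<comment> \<open>As G has q elements, the harmonic bound says that 1 - 1/t_i has a nonnegative
    sum over G for each i separately; no joint information about the t_i enters.\<close>
  have "q \<le> q + real (card I) * q - (\<Sum>i\<in>I. q)" by simp
  also have "\<dots> \<le> q + real (card I) * q - (\<Sum>i\<in>I. \<Sum>g\<in>G. 1 / (deg i g / D i))"
    using harm by (intro diff_left_mono sum_mono) auto
  also have "\<dots> = (\<Sum>g\<in>G. 1 + (\<Sum>i\<in>I. 1 - 1 / (deg i g / D i)))"
    by (subst sum.swap) (simp add: sum.distrib sum_subtractf cardG distrib_left mult.commute)
  also have "\<dots> \<le> (\<Sum>g\<in>G. \<Prod>i\<in>I. deg i g / D i)"
    using degpos D by (intro sum_mono prod_ge_one_plus_sum) auto
  also have "\<dots> = (\<Sum>g\<in>G. \<Prod>i\<in>I. deg i g) / (\<Prod>i\<in>I. D i)"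
    by (simp add: prod_dividef sum_divide_distrib)
  finally have "q * (\<Prod>i\<in>I. D i) \<le> (\<Sum>g\<in>G. \<Prod>i\<in>I. deg i g)"
    using D by (simp add: pos_le_divide_eq prod_pos)
  also have "\<dots> = (\<Sum>g\<in>K \<rightarrow>\<^sub>E V. of_bool (g ` K \<in> H) * (\<Prod>i\<in>I. deg i g))"
    unfolding G_def using K V by (subst sum.inter_filter) (simp_all add: finite_PiE of_bool_def if_distrib[of "\<lambda>x. x * _"] cong: if_cong)
  also have "\<dots> = (\<Sum>\<phi>\<in>(K \<union> (\<Union>i\<in>I. E i)) \<rightarrow>\<^sub>E V. of_bool (restrict \<phi> K ` K \<in> H) * (\<Prod>i\<in>I. of_bool (\<phi> ` E i \<in> H)))"
    unfolding deg_def using I V K E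
    by (intro sum_pendant_edges[symmetric, where w = "\<lambda>g. of_bool (g ` K \<in> H)"]) auto
  also have "\<dots> = (\<Sum>\<phi>\<in>(K \<union> (\<Union>i\<in>I. E i)) \<rightarrow>\<^sub>E V. of_bool (\<phi> ` K \<in> H \<and> (\<forall>i\<in>I. \<phi> ` E i \<in> H)))"
  proof (rule sum.cong[OF refl])
    fix \<phi> :: "'j \<Rightarrow> 'v"
    have "restrict \<phi> K ` K = \<phi> ` K" by (intro image_cong) auto
    moreover have "(\<Prod>i\<in>I. of_bool (\<phi> ` E i \<in> H)) = (of_bool (\<forall>i\<in>I. \<phi> ` E i \<in> H) :: real)"
      using I by (induction I rule: finite_induct) auto
    ultimately show "of_bool (restrict \<phi> K ` K \<in> H) * (\<Prod>i\<in>I. of_bool (\<phi> ` E i \<in> H)) =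
        (of_bool (\<phi> ` K \<in> H \<and> (\<forall>i\<in>I. \<phi> ` E i \<in> H)) :: real)" by simp
  qed
  also have "\<dots> = real (card {\<phi> \<in> (K \<union> (\<Union>i\<in>I. E i)) \<rightarrow>\<^sub>E V. \<phi> ` K \<in> H \<and> (\<forall>i\<in>I. \<phi> ` E i \<in> H)})"
    using I V K E by (simp add: finite_PiE Int_def)
  finally show ?thesis by (simp add: q_def D_def)
qed

text \<open>This counts the maps on which the averaging conditions. Since \<open>K\<close> meets no
  \<open>E i\<close>, every degree involved is that of the empty set.\<close>

lemma hom_count_disjoint_edges:
  fixes E :: "'i \<Rightarrow> 'j set" and V :: "'v set"
  assumes I: "finite I" and V: "finite V"
    and H: "\<And>e. e \<in> H \<Longrightarrow> e \<subseteq> V \<and> card e = r"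
    and K: "finite K" "\<And>i. i \<in> I \<Longrightarrow> E i \<inter> K = {}"
    and E: "\<And>i. i \<in> I \<Longrightarrow> finite (E i) \<and> card (E i) = r" "disjoint_family_on E I"
  shows "real (card {\<phi> \<in> (K \<union> (\<Union>i\<in>I. E i)) \<rightarrow>\<^sub>E V. \<forall>i\<in>I. \<phi> ` E i \<in> H})
    = real (card V) ^ card K * real (fact r * card H) ^ card I"
proof -
  have "real (card {\<phi> \<in> (K \<union> (\<Union>i\<in>I. E i)) \<rightarrow>\<^sub>E V. \<forall>i\<in>I. \<phi> ` E i \<in> H})
     = (\<Sum>\<phi>\<in>(K \<union> (\<Union>i\<in>I. E i)) \<rightarrow>\<^sub>E V. of_bool (\<forall>i\<in>I. \<phi> ` E i \<in> H))"
    using I V K E by (simp add: finite_PiE Int_def)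
  also have "\<dots> = (\<Sum>\<phi>\<in>(K \<union> (\<Union>i\<in>I. E i)) \<rightarrow>\<^sub>E V. 1 * (\<Prod>i\<in>I. of_bool (\<phi> ` E i \<in> H)))"
  proof (rule sum.cong[OF refl])
    fix \<phi> :: "'j \<Rightarrow> 'v"
    show "of_bool (\<forall>i\<in>I. \<phi> ` E i \<in> H) = 1 * (\<Prod>i\<in>I. of_bool (\<phi> ` E i \<in> H) :: real)"
      using I by (induction I rule: finite_induct) auto
  qed
  also have "\<dots> = (\<Sum>g\<in>K \<rightarrow>\<^sub>E V. 1 * (\<Prod>i\<in>I. real (ext_count V H (E i - K) (g ` (E i \<inter> K)))))"
    using I V K E by (intro sum_pendant_edges) auto
  also have "\<dots> = (\<Sum>g\<in>K \<rightarrow>\<^sub>E V. \<Prod>i\<in>I. real (fact r * card H))"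
  proof (intro sum.cong refl)
    fix g :: "'j \<Rightarrow> 'v"
    have "ext_count V H (E i - K) (g ` (E i \<inter> K)) = fact r * card H" if "i \<in> I" for i :: 'i
    proof -
      have "E i - K = E i" using K(2)[OF that] by auto
      then show ?thesis using ext_count_empty[OF V H, where D = "E i"] K(2)[OF that] E(1)[OF that] by simp
    qed
    then show "1 * (\<Prod>i\<in>I. real (ext_count V H (E i - K) (g ` (E i \<inter> K)))) = (\<Prod>i\<in>I. real (fact r * card H))"
      by simp
  qed
  also have "\<dots> = real (card V) ^ card K * real (fact r * card H) ^ card I"
    using K by (simp add: card_funcsetE)
  finally show ?thesis .
qed

section \<open>Choosing one map by averaging\<close>

lemma card_not_inj_le:
  assumes "finite J" "finite V" "W \<subseteq> J"
  shows "card {\<phi> \<in> J \<rightarrow>\<^sub>E V. \<not> inj_on \<phi> W} * card V \<le> (card W)\<^sup>2 * card V ^ card J"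
proof -
  \<comment> \<open>Union bound over the ordered pairs of distinct points of W: a collision of x and
    y leaves one coordinate less to choose, which saves a factor |V|.\<close>
  define Z where "Z = (\<lambda>(x, y). {\<phi> \<in> J \<rightarrow>\<^sub>E V. \<phi> x = \<phi> y})"
  define P where "P = {(x, y) \<in> W \<times> W. x \<noteq> y}"
  have finW: "finite W" using assms finite_subset by blast
  then have finP: "finite P" by (auto simp: P_def intro: finite_subset[of _ "W \<times> W"])
  have finZ: "finite (Z p)" for p using assms by (auto simp: Z_def finite_PiE split: prod.split)
  have Z: "card (Z p) * card V \<le> card V ^ card J" if p: "p \<in> P" for p
  proof -
    obtain x y where xy: "p = (x, y)" "x \<in> J" "y \<in> J" "x \<noteq> y"
      using p assms(3) by (auto simp: P_def)
    have "card (Z p) \<le> card ((J - {y}) \<rightarrow>\<^sub>E V)"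
    proof (rule card_inj_on_le[where f = "\<lambda>\<phi>. restrict \<phi> (J - {y})"])
      show "inj_on (\<lambda>\<phi>. restrict \<phi> (J - {y})) (Z p)"
      proof (rule inj_onI)
        fix \<phi> \<phi>' assume mem: "\<phi> \<in> Z p" "\<phi>' \<in> Z p"
          and eq: "restrict \<phi> (J - {y}) = restrict \<phi>' (J - {y})"
        have e: "\<phi> z = \<phi>' z" if "z \<in> J - {y}" for z using fun_cong[OF eq, of z] that by simp
        then have "\<phi> z = \<phi>' z" if "z \<in> J" for z
          using e[of x] that xy mem by (cases "z = y") (auto simp: Z_def)
        then show "\<phi> = \<phi>'" using mem xy(1) by (auto simp: Z_def intro: PiE_ext)
      qed
      show "(\<lambda>\<phi>. restrict \<phi> (J - {y})) ` Z p \<subseteq> (J - {y}) \<rightarrow>\<^sub>E V"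
      proof (rule image_subsetI)
        fix \<phi> assume "\<phi> \<in> Z p"
        then have "\<phi> \<in> J \<rightarrow>\<^sub>E V" using xy(1) by (simp add: Z_def)
        then show "restrict \<phi> (J - {y}) \<in> (J - {y}) \<rightarrow>\<^sub>E V" by (simp add: PiE_iff)
      qed
    qed (use assms in \<open>simp add: finite_PiE\<close>)
    also have "\<dots> = card V ^ (card J - 1)" using assms xy by (simp add: card_funcsetE)
    finally have "card (Z p) * card V \<le> card V ^ (card J - 1) * card V" by simp
    also have "\<dots> = card V ^ card J"
      using assms xy by (metis card_gt_0_iff empty_iff mult.commute power_eq_if neq0_conv)
    finally show ?thesis .
  qed
  have "{\<phi> \<in> J \<rightarrow>\<^sub>E V. \<not> inj_on \<phi> W} \<subseteq> (\<Union>p\<in>P. Z p)"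
    by (auto simp: inj_on_def P_def Z_def)
  then have "card {\<phi> \<in> J \<rightarrow>\<^sub>E V. \<not> inj_on \<phi> W} \<le> card (\<Union>p\<in>P. Z p)"
    using finP finZ by (intro card_mono) auto
  also have "\<dots> \<le> (\<Sum>p\<in>P. card (Z p))" by (rule card_UN_le[OF finP])
  finally have "card {\<phi> \<in> J \<rightarrow>\<^sub>E V. \<not> inj_on \<phi> W} * card V \<le> (\<Sum>p\<in>P. card (Z p)) * card V" by simp
  also have "\<dots> = (\<Sum>p\<in>P. card (Z p) * card V)" by (rule sum_distrib_right)
  also have "\<dots> \<le> (\<Sum>p\<in>P. card V ^ card J)" by (intro sum_mono Z)
  also have "\<dots> = card P * card V ^ card J" by simp
  also have "card P \<le> card (W \<times> W)" using finW by (intro card_mono) (auto simp: P_def)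
  finally show ?thesis by (simp add: card_cartesian_product power2_eq_square)
qed

text \<open>Among all maps, the share sending every \<open>E i\<close> to an edge is
  \<open>\<rho> ^ card I\<close>, and under this condition each tuple S is good with probability at
  least \<rho>. If every map injective on W had at most an \<alpha>-fraction of good tuples, the
  maps not injective on W would have to supply a share of at least
  \<open>\<rho> ^ card I * (\<rho> - \<alpha>)\<close>; their share is at most |W|^2 / |V|, which
  \<open>large\<close> excludes. The set \<open>Y\<close> pads the central set to r points.\<close>

lemma exists_hom_many_central_edges:
  fixes E :: "'i \<Rightarrow> 'j set" and V :: "'v set" and H :: "'v set set" and I :: "'i set" and A :: "'j set"
    and r :: nat and \<alpha> :: real and b :: "'i \<Rightarrow> nat"
  defines "W \<equiv> A \<union> (\<Union>i\<in>I. E i)" and "T \<equiv> PiE I (\<lambda>i. {B. B \<subseteq> E i \<and> card B = b i})"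
    and "\<rho> \<equiv> real (fact r * card H) / real (card V) ^ r"
  assumes I: "finite I" and V: "finite V" "V \<noteq> {}"
    and H: "\<And>e. e \<in> H \<Longrightarrow> e \<subseteq> V \<and> card e = r"
    and E: "\<And>i. i \<in> I \<Longrightarrow> finite (E i) \<and> card (E i) = r" "disjoint_family_on E I"
    and A: "finite A" "A \<inter> (\<Union>i\<in>I. E i) = {}" and Y: "finite Y" "Y \<inter> W = {}"
    and b: "\<And>i. i \<in> I \<Longrightarrow> b i \<le> r" and r: "card A + (\<Sum>i\<in>I. b i) + card Y = r"
    and \<alpha>: "\<alpha> \<ge> 0" and large: "(real (card W))\<^sup>2 < real (card V) * (\<rho> ^ card I * (\<rho> - \<alpha>))"
  shows "\<exists>\<phi> \<in> (W \<union> Y) \<rightarrow>\<^sub>E V. inj_on \<phi> W \<and> (\<forall>i\<in>I. \<phi> ` E i \<in> H) \<and>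
    \<alpha> * real (card T) < real (card {S \<in> T. \<phi> ` (A \<union> Y \<union> (\<Union>i\<in>I. S i)) \<in> H})"
proof (rule ccontr)
  assume contr: "\<not> ?thesis"
  define J where "J = W \<union> Y"
  define q where "q = real (fact r * card H)"
  define n where "n = real (card V)"
  define K where "K S = A \<union> Y \<union> (\<Union>i\<in>I. S i)" for S :: "'i \<Rightarrow> 'j set"
  define X where "X = {\<phi> \<in> J \<rightarrow>\<^sub>E V. \<forall>i\<in>I. \<phi> ` E i \<in> H}"
  define Bad where "Bad = {\<phi> \<in> J \<rightarrow>\<^sub>E V. \<not> inj_on \<phi> W}"
  have n: "n > 0" using V by (simp add: n_def card_gt_0_iff)
  have finE: "finite (E i)" if "i \<in> I" for i using E(1)[OF that] by simp
  have finJ: "finite J" using A Y I finE by (simp add: J_def W_def)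
  have finX: "finite X" and finBad: "finite Bad" using finJ V by (simp_all add: X_def Bad_def finite_PiE)
  have finT: "finite T" using I finE by (auto simp: T_def intro: finite_PiE)
  have "card (\<Union>i\<in>I. E i) = (\<Sum>i\<in>I. card (E i))"
    using I finE E(2) by (intro card_UN_disjoint') auto
  then have cardE: "card (\<Union>i\<in>I. E i) = card I * r" using E(1) by simp
  have AY: "card (A \<union> Y) = card A + card Y" using A Y by (intro card_Un_disjoint) (auto simp: W_def)
  have J_eq: "J = (A \<union> Y) \<union> (\<Union>i\<in>I. E i)" by (auto simp: J_def W_def)
  have AY_E: "(A \<union> Y) \<inter> (\<Union>i\<in>I. E i) = {}" using A Y by (auto simp: W_def)
  have cardJ: "card J = card (A \<union> Y) + card I * r"
    unfolding J_eq cardE[symmetric] using A Y I finE AY_E by (intro card_Un_disjoint) auto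
  have count: "q * (\<Prod>i\<in>I. q / n ^ b i) \<le> real (card {\<phi>\<in>X. \<phi> ` K S \<in> H})" if S: "S \<in> T" for S
  proof -
    have S': "S i \<subseteq> E i" "card (S i) = b i" if "i \<in> I" for i
      using S that by (auto simp: T_def PiE_iff)
    have finS: "finite (S i)" if "i \<in> I" for i using S'[OF that] finE[OF that] finite_subset by blast
    have "disjoint_family_on S I"
      using E(2) S'(1) by (fastforce simp: disjoint_family_on_def)
    then have "card (\<Union>i\<in>I. S i) = (\<Sum>i\<in>I. card (S i))"
      using I finS by (intro card_UN_disjoint') auto
    moreover have "(A \<union> Y) \<inter> (\<Union>i\<in>I. S i) = {}" using AY_E S'(1) by blast
    ultimately have cardK: "card (K S) = r"
      unfolding K_def using A Y I finS S'(2) r AY by (subst card_Un_disjoint) auto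
    have finK: "finite (K S)" using A Y I finS by (simp add: K_def)
    have "E i \<inter> K S = S i" if "i \<in> I" for i
      using E(2) S'(1) AY_E that unfolding K_def disjoint_family_on_def by fastforce
    then have "card (E i \<inter> K S) = b i" if "i \<in> I" for i using S'(2) that by simp
    then have "q * (\<Prod>i\<in>I. q / n ^ b i) = q * (\<Prod>i\<in>I. q / n ^ card (E i \<inter> K S))" by simp
    also have "\<dots> \<le> real (card {\<phi> \<in> (K S \<union> (\<Union>i\<in>I. E i)) \<rightarrow>\<^sub>E V. \<phi> ` K S \<in> H \<and> (\<forall>i\<in>I. \<phi> ` E i \<in> H)})"
      unfolding q_def n_def by (rule hom_count_lower_bound[OF I V H finK cardK E])
    also have "K S \<union> (\<Union>i\<in>I. E i) = J" using S'(1) by (auto simp: J_eq K_def)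
    also have "{\<phi> \<in> J \<rightarrow>\<^sub>E V. \<phi> ` K S \<in> H \<and> (\<forall>i\<in>I. \<phi> ` E i \<in> H)} = {\<phi>\<in>X. \<phi> ` K S \<in> H}"
      by (auto simp: X_def)
    finally show ?thesis .
  qed
  have cardX: "real (card X) = n ^ card (A \<union> Y) * q ^ card I"
    unfolding X_def J_eq n_def q_def
    by (rule hom_count_disjoint_edges[OF I V(1) H _ _ E]) (use A Y AY_E in auto)
  have "real (card T) * (q * (\<Prod>i\<in>I. q / n ^ b i)) \<le> (\<Sum>S\<in>T. real (card {\<phi>\<in>X. \<phi> ` K S \<in> H}))"
    using sum_bounded_below[of T _ "\<lambda>S. real (card {\<phi>\<in>X. \<phi> ` K S \<in> H})"] count by simp
  also have "\<dots> = (\<Sum>\<phi>\<in>X. real (card {S\<in>T. \<phi> ` K S \<in> H}))"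
    using sum_card_swap[OF finT finX, of "\<lambda>S \<phi>. \<phi> ` K S \<in> H"] by (simp flip: of_nat_sum)
  also have "\<dots> \<le> (\<Sum>\<phi>\<in>X. \<alpha> * real (card T) + of_bool (\<phi> \<in> Bad) * real (card T))"
  proof (rule sum_mono)
    fix \<phi> assume \<phi>: "\<phi> \<in> X"
    show "real (card {S\<in>T. \<phi> ` K S \<in> H}) \<le> \<alpha> * real (card T) + of_bool (\<phi> \<in> Bad) * real (card T)"
    proof (cases "\<phi> \<in> Bad")
      case True
      have "card {S\<in>T. \<phi> ` K S \<in> H} \<le> card T" using finT by (intro card_mono) auto
      then show ?thesis using True \<alpha> by (simp add: add_increasing)
    next
      case False
      then have "\<phi> \<in> (W \<union> Y) \<rightarrow>\<^sub>E V" "inj_on \<phi> W" "\<forall>i\<in>I. \<phi> ` E i \<in> H"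
        using \<phi> by (auto simp: X_def Bad_def J_def)
      then show ?thesis using contr False by (fastforce simp: K_def not_less)
    qed
  qed
  also have "\<dots> = real (card T) * (\<alpha> * real (card X) + real (card (X \<inter> Bad)))"
    using finX by (simp add: sum.distrib flip: sum_distrib_right) (simp add: algebra_simps Int_def)
  also have "\<dots> \<le> real (card T) * (\<alpha> * real (card X) + real (card Bad))"
    using finBad by (intro mult_left_mono add_left_mono) (auto intro: card_mono)
  finally have "real (card T) * (q * (\<Prod>i\<in>I. q / n ^ b i)) \<le> real (card T) * (\<alpha> * real (card X) + real (card Bad))" .
  moreover have "card T > 0"
    unfolding T_def using I E(1) b by (simp add: card_PiE n_subsets prod_pos)
  ultimately have "q * (\<Prod>i\<in>I. q / n ^ b i) \<le> \<alpha> * real (card X) + real (card Bad)" by simp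
  also have "(\<Prod>i\<in>I. q / n ^ b i) = q ^ card I / n ^ (\<Sum>i\<in>I. b i)"
    by (simp add: prod_dividef power_sum)
  finally have 1: "q * (q ^ card I / n ^ (\<Sum>i\<in>I. b i)) \<le> \<alpha> * (n ^ card (A \<union> Y) * q ^ card I) + real (card Bad)"
    unfolding cardX .
  \<comment> \<open>Multiplying by n to the sum of the b_i clears the denominator; |A \<union> Y|
    plus that sum is r, so n^r appears.\<close>
  have "q * q ^ card I = q * (q ^ card I / n ^ (\<Sum>i\<in>I. b i)) * n ^ (\<Sum>i\<in>I. b i)" using n by simp
  also have "\<dots> \<le> (\<alpha> * (n ^ card (A \<union> Y) * q ^ card I) + real (card Bad)) * n ^ (\<Sum>i\<in>I. b i)"
    using n by (intro mult_right_mono[OF 1]) simp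
  also have "\<dots> = \<alpha> * q ^ card I * n ^ r + real (card Bad) * n ^ (\<Sum>i\<in>I. b i)"
    using r AY by (simp add: algebra_simps flip: power_add)
  finally have "n * (q * q ^ card I) \<le> n * (\<alpha> * q ^ card I * n ^ r + real (card Bad) * n ^ (\<Sum>i\<in>I. b i))"
    using n by simp
  also have "\<dots> = n * \<alpha> * q ^ card I * n ^ r + real (card Bad * card V) * n ^ (\<Sum>i\<in>I. b i)"
    by (simp add: n_def algebra_simps)
  also have "real (card Bad * card V) \<le> real ((card W)\<^sup>2 * card V ^ card J)"
    unfolding Bad_def by (intro of_nat_mono card_not_inj_le finJ V) (auto simp: J_def)
  finally have "n * (q * q ^ card I) \<le> n * \<alpha> * q ^ card I * n ^ r + (real (card W))\<^sup>2 * n ^ card J * n ^ (\<Sum>i\<in>I. b i)"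
    using n by (simp add: n_def)
  also have "(real (card W))\<^sup>2 * n ^ card J * n ^ (\<Sum>i\<in>I. b i) = (real (card W))\<^sup>2 * (n ^ r * n ^ (r * card I))"
  proof -
    have "card J + (\<Sum>i\<in>I. b i) = r + r * card I" using cardJ AY r by (simp add: mult.commute)
    then show ?thesis by (simp add: mult.assoc flip: power_add)
  qed
  finally have 2: "n * (q * q ^ card I - \<alpha> * q ^ card I * n ^ r) \<le> (real (card W))\<^sup>2 * (n ^ r * n ^ (r * card I))"
    by (simp add: algebra_simps)
  have "q = \<rho> * n ^ r" using n by (simp add: \<rho>_def q_def n_def)
  then have "q * q ^ card I - \<alpha> * q ^ card I * n ^ r = \<rho> ^ card I * (\<rho> - \<alpha>) * (n ^ r * n ^ (r * card I))"
    by (simp add: power_mult_distrib power_mult algebra_simps)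
  with 2 have "(n * (\<rho> ^ card I * (\<rho> - \<alpha>))) * (n ^ r * n ^ (r * card I)) \<le> (real (card W))\<^sup>2 * (n ^ r * n ^ (r * card I))"
    by (simp add: mult.assoc)
  then have "n * (\<rho> ^ card I * (\<rho> - \<alpha>)) \<le> (real (card W))\<^sup>2"
    using n by (simp add: mult_le_cancel_right)
  with large show False by (simp add: n_def)
qed

section \<open>Edges through sets of the shadow\<close>

text \<open>All subsets of edges, of every size from 0 to r, since the partial edges to be completed
  have arbitrary sizes.\<close>

definition shadow :: "'v set set \<Rightarrow> 'v set set" where
  "shadow H = {S. \<exists>e\<in>H. S \<subseteq> e}"

definition codeg :: "'v set set \<Rightarrow> 'v set \<Rightarrow> nat" where
  "codeg H S = card {e\<in>H. S \<subseteq> e}"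

lemma binomial_le_power: "n choose k \<le> n ^ k"
  by (cases "k \<le> n") (auto simp: binomial_le_pow binomial_eq_0)

text \<open>For each of the r + 1 sizes k there are at most n^k sets, each of weight \<eta> n^(r-k),
  so every size contributes at most \<eta> n^r.\<close>

lemma sum_power_shadow_le:
  fixes \<eta> :: real
  assumes V: "finite V" and H: "\<And>e. e \<in> H \<Longrightarrow> e \<subseteq> V \<and> card e = r" and \<eta>: "\<eta> \<ge> 0"
  shows "(\<Sum>S\<in>shadow H. \<eta> * real (card V) ^ (r - card S)) \<le> real (r + 1) * \<eta> * real (card V) ^ r"
proof -
  let ?n = "real (card V)"
  let ?T = "{S. S \<subseteq> V \<and> card S \<le> r}"
  have finT: "finite ?T" using V by simp
  have "S \<subseteq> V \<and> card S \<le> r" if S: "S \<in> shadow H" for S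
  proof -
    obtain e where e: "e \<in> H" "S \<subseteq> e" using S by (auto simp: shadow_def)
    then have "finite e" using H[OF e(1)] V finite_subset by blast
    then show ?thesis using e(2) H[OF e(1)] card_mono[of e S] by auto
  qed
  then have "(\<Sum>S\<in>shadow H. \<eta> * ?n ^ (r - card S)) \<le> (\<Sum>S\<in>?T. \<eta> * ?n ^ (r - card S))"
    using \<eta> by (intro sum_mono2[OF finT]) auto
  also have "\<dots> = (\<Sum>k\<in>{..r}. \<Sum>S\<in>{S\<in>?T. card S = k}. \<eta> * ?n ^ (r - card S))"
    using finT by (intro sum.group[symmetric]) auto
  also have "\<dots> \<le> (\<Sum>k\<in>{..r}. \<eta> * ?n ^ r)"
  proof (rule sum_mono)
    fix k assume k: "k \<in> {..r}"
    have "(\<Sum>S\<in>{S\<in>?T. card S = k}. \<eta> * ?n ^ (r - card S)) = (\<Sum>S\<in>{S. S \<subseteq> V \<and> card S = k}. \<eta> * ?n ^ (r - k))"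
      using k by (intro sum.cong) auto
    also have "\<dots> = real (card V choose k) * (\<eta> * ?n ^ (r - k))"
      using n_subsets[OF V, of k] by simp
    also have "\<dots> \<le> ?n ^ k * (\<eta> * ?n ^ (r - k))"
    proof (rule mult_right_mono)
      show "real (card V choose k) \<le> ?n ^ k"
        using binomial_le_power[of "card V" k] of_nat_mono by fastforce
    qed (use \<eta> in simp)
    also have "\<dots> = \<eta> * (?n ^ k * ?n ^ (r - k))" by simp
    also have "?n ^ k * ?n ^ (r - k) = ?n ^ r" using k by (simp flip: power_add)
    finally show "(\<Sum>S\<in>{S\<in>?T. card S = k}. \<eta> * ?n ^ (r - card S)) \<le> \<eta> * ?n ^ r" .
  qed
  also have "\<dots> = real (r + 1) * \<eta> * ?n ^ r" by simp
  finally show ?thesis .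
qed

text \<open>Take \<open>H'\<close> maximizing the number of edges minus the total weight of the shadow: removing all
  edges through a set of low codegree would increase this quantity.\<close>

lemma exists_cleaned_subgraph:
  fixes \<eta> :: real
  assumes V: "finite V" and H: "\<And>e. e \<in> H \<Longrightarrow> e \<subseteq> V \<and> card e = r" and \<eta>: "\<eta> \<ge> 0"
  obtains H' where "H' \<subseteq> H" "real (card H) \<le> real (card H') + real (r + 1) * \<eta> * real (card V) ^ r"
    "\<And>S. S \<in> shadow H' \<Longrightarrow> \<eta> * real (card V) ^ (r - card S) \<le> real (codeg H' S)"
proof -
  \<comment> \<open>The weight of a set is the codegree demanded of it, so a violating set has more
    weight than edges through it.\<close>
  define wt where "wt S = \<eta> * real (card V) ^ (r - card S)" for S :: "'a set"
  define \<Phi> where "\<Phi> G = real (card G) - (\<Sum>S\<in>shadow G. wt S)" for G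
  have finH: "finite H" by (rule finite_subset[of _ "Pow V"]) (use H V in auto)
  have wt: "wt S \<ge> 0" for S using \<eta> by (simp add: wt_def)
  have "Max (\<Phi> ` Pow H) \<in> \<Phi> ` Pow H" using finH by (intro Max_in) auto
  then obtain G where G: "G \<subseteq> H" "\<Phi> G = Max (\<Phi> ` Pow H)" by (metis (no_types, lifting) PowD imageE)
  have max: "\<Phi> G' \<le> \<Phi> G" if "G' \<subseteq> H" for G' using finH that G(2) by simp
  have finG: "finite G" using G finH finite_subset by blast
  have fin_shadow: "finite (shadow G')" if "G' \<subseteq> H" for G'
  proof (rule finite_subset)
    show "shadow G' \<subseteq> Pow V" using H that by (fastforce simp: shadow_def)
  qed (use V in simp)
  have low: "wt S \<le> real (codeg G S)" if S: "S \<in> shadow G" for S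
  proof (rule ccontr)
    assume less: "\<not> wt S \<le> real (codeg G S)"
    let ?G' = "G - {e\<in>G. S \<subseteq> e}"
    have "shadow ?G' \<subseteq> shadow G - {S}" by (auto simp: shadow_def)
    then have "(\<Sum>S\<in>shadow ?G'. wt S) \<le> (\<Sum>S\<in>shadow G - {S}. wt S)"
      using fin_shadow[OF G(1)] wt by (intro sum_mono2) auto
    also have "\<dots> = (\<Sum>S\<in>shadow G. wt S) - wt S"
      using fin_shadow[OF G(1)] S by (simp add: sum_diff1)
    finally have "(\<Sum>S\<in>shadow ?G'. wt S) \<le> (\<Sum>S\<in>shadow G. wt S) - wt S" .
    moreover have "real (card ?G') = real (card G) - real (codeg G S)"
    proof -
      have "card ?G' = card G - codeg G S"
        unfolding codeg_def using finG by (intro card_Diff_subset) auto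
      moreover have "codeg G S \<le> card G"
        unfolding codeg_def using finG by (intro card_mono) auto
      ultimately show ?thesis by simp
    qed
    ultimately have "\<Phi> G < \<Phi> ?G'" using less by (simp add: \<Phi>_def)
    moreover have "\<Phi> ?G' \<le> \<Phi> G" using G(1) by (intro max) auto
    ultimately show False by simp
  qed
  have "real (card H) - real (r + 1) * \<eta> * real (card V) ^ r \<le> \<Phi> H"
    unfolding \<Phi>_def wt_def using sum_power_shadow_le[OF V H \<eta>] by simp
  also have "\<dots> \<le> \<Phi> G" by (intro max) simp
  also have "\<dots> \<le> real (card G)" using wt by (simp add: \<Phi>_def sum_nonneg)
  finally show thesis using G(1) low by (intro that[of G]) (auto simp: wt_def)
qed

lemma codeg_le:
  assumes V: "finite V" and H: "\<And>e. e \<in> H \<Longrightarrow> e \<subseteq> V \<and> card e = r"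
  shows "codeg H S \<le> card V ^ (r - card S)"
proof -
  have "codeg H S \<le> card {U. U \<subseteq> V \<and> card U = r - card S}"
    unfolding codeg_def
  proof (rule card_inj_on_le[where f = "\<lambda>e. e - S"])
    show "inj_on (\<lambda>e. e - S) {e\<in>H. S \<subseteq> e}" by (rule inj_onI) (metis (lifting) Diff_partition mem_Collect_eq)
    show "(\<lambda>e. e - S) ` {e\<in>H. S \<subseteq> e} \<subseteq> {U. U \<subseteq> V \<and> card U = r - card S}"
    proof (rule image_subsetI)
      fix e assume e: "e \<in> {e\<in>H. S \<subseteq> e}"
      then have "S \<subseteq> V" using H[of e] by auto
      then have "finite S" using V finite_subset by blast
      then show "e - S \<in> {U. U \<subseteq> V \<and> card U = r - card S}"
        using e H[of e] by (auto simp: card_Diff_subset)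
    qed
  qed (use V in simp)
  also have "\<dots> \<le> card V ^ (r - card S)"
    using n_subsets[OF V] binomial_le_power by metis
  finally show ?thesis .
qed

text \<open>An edge through S that meets X outside S contains S and one more point of X. There are
  at most |X| n^(r-|S|-1) such edges, fewer than the \<eta> n^(r-|S|) through S.\<close>

lemma exists_edge_avoiding:
  fixes \<eta> :: real
  assumes V: "finite V" and H: "\<And>e. e \<in> H \<Longrightarrow> e \<subseteq> V \<and> card e = r"
    and S: "S \<in> shadow H" "\<eta> * real (card V) ^ (r - card S) \<le> real (codeg H S)"
    and X: "finite X" "real (card X) < \<eta> * real (card V)"
  obtains e where "e \<in> H" "S \<subseteq> e" "(e - S) \<inter> X = {}"
proof (rule ccontr)
  assume contr: "\<not> thesis"
  obtain e0 where e0: "e0 \<in> H" "S \<subseteq> e0" using S(1) by (auto simp: shadow_def)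
  have fin: "finite e0" "finite S" using e0 H V finite_subset by metis+
  then have "card S \<le> r" using e0 H card_mono by metis
  \<comment> \<open>A shadow set of size r is an edge and needs no completion. Excluding it makes
    the exponent r - |S| - 1 a genuine one, as subtraction truncates at 0.\<close>
  moreover have "card S \<noteq> r"
  proof
    assume "card S = r"
    then have "S = e0" using e0 fin H by (intro card_subset_eq) auto
    then show False using contr that[of e0] e0 by auto
  qed
  ultimately have s: "card S < r" by simp
  have finH: "finite H" by (rule finite_subset[of _ "Pow V"]) (use H V in auto)
  note avoid = that
  have "(e - S) \<inter> X \<noteq> {}" if "e \<in> H" "S \<subseteq> e" for e
    using contr avoid[OF that] by auto
  then have "{e\<in>H. S \<subseteq> e} \<subseteq> (\<Union>x\<in>X - S. {e\<in>H. insert x S \<subseteq> e})"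
    by fast
  then have "codeg H S \<le> card (\<Union>x\<in>X - S. {e\<in>H. insert x S \<subseteq> e})"
    unfolding codeg_def using X(1) finH by (intro card_mono) auto
  also have "\<dots> \<le> (\<Sum>x\<in>X - S. codeg H (insert x S))"
    unfolding codeg_def using X(1) by (intro card_UN_le) auto
  also have "\<dots> \<le> (\<Sum>x\<in>X - S. card V ^ (r - Suc (card S)))"
  proof (rule sum_mono)
    fix x assume "x \<in> X - S"
    then have "card (insert x S) = Suc (card S)" using fin by simp
    then show "codeg H (insert x S) \<le> card V ^ (r - Suc (card S))"
      using codeg_le[OF V H, where S = "insert x S"] by simp
  qed
  also have "\<dots> \<le> card X * card V ^ (r - Suc (card S))"
    using X(1) by (simp add: card_mono)
  finally have "\<eta> * real (card V) ^ (r - card S) \<le> real (card X * card V ^ (r - Suc (card S)))"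
    using S(2) of_nat_mono by (meson order_trans of_nat_le_iff)
  also have "r - card S = Suc (r - Suc (card S))" using s by simp
  finally have "(\<eta> * real (card V)) * real (card V) ^ (r - Suc (card S)) \<le> real (card X) * real (card V) ^ (r - Suc (card S))"
    by (simp add: mult.assoc)
  moreover have "card V > 0"
    using X(2) by (metis mult_zero_right neq0_conv of_nat_0 of_nat_0_le_iff not_less)
  ultimately have "\<eta> * real (card V) \<le> real (card X)" by (simp add: mult_le_cancel_right)
  then show False using X(2) by simp
qed

section \<open>Embedding the extension\<close>

text \<open>The sets \<open>E i\<close> already have r elements, so their private sets are empty and
  only the last two partial edges receive new vertices. List positions start at 0, hence position j
  holds \<open>E (Suc j)\<close>.\<close>

lemma is_T_elim:
  assumes "is_T r a m b c d F"
  obtains E :: "nat \<Rightarrow> 'v set" and A B C U U' where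
    "disjoint_family_on E {1..m}" "\<And>i. i \<in> {1..m} \<Longrightarrow> finite (E i) \<and> card (E i) = r"
    "finite A" "card A = a" "A \<inter> (\<Union>i\<in>{1..m}. E i) = {}"
    "\<And>i. i \<in> {1..m} \<Longrightarrow> B i \<subseteq> E i \<and> C i \<subseteq> E i \<and> card (B i) = b i \<and> card (C i) = c i \<and> card (B i \<inter> C i) = d i"
    "finite U" "card U = r - card (A \<union> (\<Union>i\<in>{1..m}. B i))" "U \<inter> (A \<union> (\<Union>i\<in>{1..m}. E i)) = {}"
    "finite U'" "card U' = r - card (A \<union> (\<Union>i\<in>{1..m}. C i))" "U' \<inter> (A \<union> (\<Union>i\<in>{1..m}. E i)) = {}"
    "U \<inter> U' = {}"
    "F = (A \<union> (\<Union>i\<in>{1..m}. E i) \<union> U \<union> U',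
          E ` {1..m} \<union> {A \<union> (\<Union>i\<in>{1..m}. B i) \<union> U, A \<union> (\<Union>i\<in>{1..m}. C i) \<union> U'})"
proof -
  obtain E :: "nat \<Rightarrow> 'v set" and A B C where
    E1: "disjoint_family_on E {1..m}" and E2: "\<forall>i\<in>{1..m}. finite (E i) \<and> card (E i) = r"
    and A: "finite A" "card A = a" "A \<inter> (\<Union>i\<in>{1..m}. E i) = {}"
    and BC': "\<forall>i\<in>{1..m}. B i \<subseteq> E i \<and> C i \<subseteq> E i \<and> card (B i) = b i \<and> card (C i) = c i \<and> card (B i \<inter> C i) = d i"
    and ext: "is_uniform_extension r (A \<union> (\<Union>i\<in>{1..m}. E i))
          (map E [1..<Suc m] @ [A \<union> (\<Union>i\<in>{1..m}. B i), A \<union> (\<Union>i\<in>{1..m}. C i)]) F"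
    using assms unfolding is_T_def by (elim exE conjE) (rule that; assumption)
  note E = E1 E2[rule_format] and BC = BC'[rule_format]
  let ?W = "A \<union> (\<Union>i\<in>{1..m}. E i)" and ?B = "A \<union> (\<Union>i\<in>{1..m}. B i)" and ?C = "A \<union> (\<Union>i\<in>{1..m}. C i)"
  define es where "es = map E [1..<Suc m] @ [?B, ?C]"
  have len: "length es = Suc (Suc m)" by (simp add: es_def)
  have nth: "es ! j = E (Suc j)" if "j < m" for j using that by (simp add: es_def nth_append del: upt_Suc)
  have nth': "es ! m = ?B" "es ! Suc m = ?C" by (simp_all add: es_def nth_append del: upt_Suc)
  obtain U where U: "\<And>j. j < length es \<Longrightarrow> finite (U j) \<and> card (U j) = r - card (es ! j) \<and> U j \<inter> ?W = {}"
    and disj: "disjoint_family_on U {..<length es}"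
    and F: "F = (?W \<union> (\<Union>j<length es. U j), {es ! j \<union> U j | j. j < length es})"
    using ext unfolding is_uniform_extension_def es_def[symmetric] by (elim exE conjE) (rule that; simp)
  have empty: "U j = {}" if "j < m" for j
    using U[of j] that E(2)[of "Suc j"] nth[OF that] by (auto simp: len)
  have "{es ! j \<union> U j | j. j < length es} = (\<lambda>j. es ! j \<union> U j) ` {..<length es}" by auto
  also have "\<dots> = (\<lambda>j. es ! j \<union> U j) ` {..<m} \<union> {?B \<union> U m, ?C \<union> U (Suc m)}"
    unfolding len lessThan_Suc by (simp only: image_insert nth') blast
  also have "(\<lambda>j. es ! j \<union> U j) ` {..<m} = (\<lambda>j. E (Suc j)) ` {..<m}"
    by (intro image_cong) (simp_all add: nth empty)
  also have "\<dots> = E ` {1..m}"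
  proof -
    have "E ` Suc ` {..<m} = E ` {1..m}" by (simp only: image_Suc_lessThan)
    then show ?thesis by (simp add: image_image)
  qed
  finally have edges: "{es ! j \<union> U j | j. j < length es} = E ` {1..m} \<union> {?B \<union> U m, ?C \<union> U (Suc m)}" .
  have verts: "(\<Union>j<length es. U j) = U m \<union> U (Suc m)"
    unfolding len lessThan_Suc using empty by auto
  show thesis
  proof (rule that[OF E A BC])
    show "F = (?W \<union> U m \<union> U (Suc m), E ` {1..m} \<union> {?B \<union> U m, ?C \<union> U (Suc m)})"
      unfolding F edges verts by (simp add: Un_assoc)
    show "U m \<inter> U (Suc m) = {}" using disj by (auto simp: disjoint_family_on_def len)
  qed (use U[of m] U[of "Suc m"] nth' len in \<open>simp_all\<close>)
qed

lemma contains_copy_mono: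
  assumes "contains_copy H F" "fst H \<subseteq> fst H'" "snd H \<subseteq> snd H'"
  shows "contains_copy H' F"
proof -
  obtain f where "inj_on f (fst F)" "f ` fst F \<subseteq> fst H" "\<forall>e\<in>snd F. f ` e \<in> snd H"
    using assms(1) unfolding contains_copy_def by (elim exE conjE)
  then show ?thesis
    using assms(2,3) unfolding contains_copy_def by (intro exI[of _ f]) auto
qed

text \<open>The two private sets are placed one after the other. The second edge has to avoid the
  image of W and the whole first edge, whence the bound |W| + r on the sets to be avoided.\<close>

lemma contains_copy_extend:
  fixes V :: "'w set" and W :: "'v set"
  assumes V: "finite V" and H: "\<And>e. e \<in> H \<Longrightarrow> e \<subseteq> V \<and> card e = r"
    and ext: "\<And>S X. S \<in> shadow H \<Longrightarrow> finite X \<Longrightarrow> card X \<le> card W + r \<Longrightarrow> \<exists>e\<in>H. S \<subseteq> e \<and> (e - S) \<inter> X = {}"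
    and W: "finite W" "P \<subseteq> W" "Q \<subseteq> W"
    and f: "inj_on f W" "f ` W \<subseteq> V" "\<And>e. e \<in> \<E> \<Longrightarrow> e \<subseteq> W \<and> f ` e \<in> H"
      "f ` P \<in> shadow H" "f ` Q \<in> shadow H"
    and U: "finite U" "card U = r - card P" "U \<inter> W = {}"
    and U': "finite U'" "card U' = r - card Q" "U' \<inter> W = {}" "U \<inter> U' = {}"
  shows "contains_copy (V, H) (W \<union> U \<union> U', \<E> \<union> {P \<union> U, Q \<union> U'})"
proof -
  have fin: "finite e" if "e \<in> H" for e using H[OF that] V finite_subset by blast
  have cW: "card (f ` W) = card W" using f(1) by (rule card_image)
  obtain e where e: "e \<in> H" "f ` P \<subseteq> e" "(e - f ` P) \<inter> f ` W = {}"
    using ext[OF f(4), of "f ` W"] W(1) cW by auto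
  have "card (f ` W \<union> e) \<le> card W + r"
    using card_Un_le[of "f ` W" e] H[OF e(1)] cW by simp
  then obtain e' where e': "e' \<in> H" "f ` Q \<subseteq> e'" "(e' - f ` Q) \<inter> (f ` W \<union> e) = {}"
    using ext[OF f(5), of "f ` W \<union> e"] W(1) fin[OF e(1)] by auto
  have card_im: "card (f ` Z) = card Z" "finite Z" if "Z \<subseteq> W" for Z
    using that f(1) W(1) by (auto intro: card_image inj_on_subset finite_subset)
  have "card (e - f ` P) = card U" "card (e' - f ` Q) = card U'"
    using e e' H U U' card_im[OF W(2)] card_im[OF W(3)] by (simp_all add: card_Diff_subset)
  then obtain g g' where g: "bij_betw g U (e - f ` P)" "bij_betw g' U' (e' - f ` Q)"
    using fin[OF e(1)] fin[OF e'(1)] U(1) U'(1) by (metis finite_same_card_bij finite_Diff)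
  define h where "h x = (if x \<in> W then f x else if x \<in> U then g x else g' x)" for x
  have hW: "h ` Z = f ` Z" if "Z \<subseteq> W" for Z
    using that by (intro image_cong) (auto simp: h_def)
  have "h ` U = g ` U" using U by (intro image_cong) (auto simp: h_def)
  then have hU: "h ` U = e - f ` P" using g by (simp add: bij_betw_def)
  have "h ` U' = g' ` U'" using U' by (intro image_cong) (auto simp: h_def)
  then have hU': "h ` U' = e' - f ` Q" using g by (simp add: bij_betw_def)
  have "inj_on h W" using f(1) by (simp add: h_def inj_on_def)
  moreover have "inj_on h U"
    using g(1) U(3) by (subst inj_on_cong[of U h g]) (auto simp: h_def bij_betw_def)
  moreover have "inj_on h U'"
    using g(2) U'(3,4) by (subst inj_on_cong[of U' h g']) (auto simp: h_def bij_betw_def)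
  moreover have "h ` W \<inter> h ` U = {}" unfolding hU hW[OF subset_refl] using e(3) by blast
  moreover have "h ` (W \<union> U) \<inter> h ` U' = {}"
    unfolding image_Un hU hU' hW[OF subset_refl] using e'(3) by blast
  moreover have "(W \<union> U) - U' = W \<union> U" "U' - (W \<union> U) = U'" "W - U = W" "U - W = U"
    using U(3) U'(3,4) by auto
  ultimately have inj: "inj_on h (W \<union> U \<union> U')" by (simp add: inj_on_Un)
  have "h ` (P \<union> U) = e" "h ` (Q \<union> U') = e'"
    unfolding image_Un hU hU' hW[OF W(2)] hW[OF W(3)] using e(2) e'(2) by auto
  moreover have "h ` x \<in> H" if "x \<in> \<E>" for x using f(3)[OF that] hW by simp
  moreover have "h ` (W \<union> U \<union> U') \<subseteq> V"
    unfolding image_Un hU hU' hW[OF subset_refl] using f(2) H[OF e(1)] H[OF e'(1)] by auto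
  ultimately show ?thesis
    unfolding contains_copy_def using inj e(1) e'(1) by (intro exI[of _ h]) auto
qed

section \<open>Placing the sets \<open>B i\<close> and \<open>C i\<close> inside a conflicting
  pair\<close>

lemma exists_subset_with_intersection:
  assumes fin: "finite S'" "finite S" and card: "card S = b" "card S' = b" and le: "d \<le> c" "c \<le> b"
    and L: "card (S \<inter> S') \<notin> {0..<d} \<union> {b - c + d + 1..b}"
  obtains C where "C \<subseteq> S'" "card C = c" "card (S \<inter> C) = d"
proof -
  have "card (S \<inter> S') \<le> b" using fin card card_mono[of S' "S \<inter> S'"] by auto
  then have d: "d \<le> card (S \<inter> S')" "card (S \<inter> S') \<le> b - c + d" using L by auto
  \<comment> \<open>C consists of d points of S \<inter> S' and c - d points of S' - S; the two
    bounds on |S \<inter> S'| say that both supplies are large enough.\<close>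
  have "card (S' - S) = b - card (S \<inter> S')"
    using fin card by (simp add: card_Diff_subset_Int Int_commute)
  then have "c - d \<le> card (S' - S)" using d le by linarith
  then obtain Y where Y: "Y \<subseteq> S' - S" "card Y = c - d" "finite Y" by (rule obtain_subset_with_card_n)
  obtain Z where Z: "Z \<subseteq> S \<inter> S'" "card Z = d" "finite Z" using d(1) by (rule obtain_subset_with_card_n)
  have "card (Y \<union> Z) = c" using Y Z le by (subst card_Un_disjoint) auto
  moreover have "S \<inter> (Y \<union> Z) = Z" using Y Z by auto
  ultimately show thesis using that[of "Y \<union> Z"] Y Z by auto
qed

lemma bij_betw_family_extend:
  fixes E :: "'i \<Rightarrow> 'a set"
  assumes disj: "disjoint_family_on E I" and A: "A \<inter> (\<Union>i\<in>I. E i) = {}"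
    and fin: "finite I" "finite A" "\<And>i. i \<in> I \<Longrightarrow> finite (E i)"
    and p: "\<And>i. i \<in> I \<Longrightarrow> bij_betw (p i) (E i) (E i)"
  obtains s where "bij_betw s (A \<union> (\<Union>i\<in>I. E i)) (A \<union> (\<Union>i\<in>I. E i))" "\<And>x. x \<in> A \<Longrightarrow> s x = x"
    "\<And>i x. i \<in> I \<Longrightarrow> x \<in> E i \<Longrightarrow> s x = p i x"
proof -
  let ?W = "A \<union> (\<Union>i\<in>I. E i)"
  define s where "s x = (if x \<in> A then x else p (THE i. i \<in> I \<and> x \<in> E i) x)" for x
  have sA: "s x = x" if "x \<in> A" for x using that by (simp add: s_def)
  have sE: "s x = p i x" if "i \<in> I" "x \<in> E i" for i x
  proof -
    have "(THE i. i \<in> I \<and> x \<in> E i) = i"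
      using that disj by (intro the_equality) (auto simp: disjoint_family_on_def)
    then show ?thesis using that A by (auto simp: s_def)
  qed
  have "s ` A = A" using sA by (auto simp: image_iff)
  moreover have "s ` E i = E i" if "i \<in> I" for i
    using sE[OF that] p[OF that] by (auto simp: bij_betw_def)
  ultimately have "s ` ?W = ?W" by (simp add: image_Un image_UN)
  moreover have "finite ?W" using fin by simp
  ultimately have "bij_betw s ?W ?W" by (simp add: bij_betw_def finite_surj_inj)
  then show thesis using sA sE that by blast
qed

section \<open>Monotone convergence of the Turan ratios\<close>

definition free_sizes :: "nat \<Rightarrow> nat \<Rightarrow> 'v hypergraph \<Rightarrow> nat set" where
  "free_sizes r n F = {card (snd H) | H :: nat hypergraph.
     is_r_graph r H \<and> card (fst H) = n \<and> \<not> contains_copy H F}"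

lemma card_edges_le:
  assumes "is_r_graph r H"
  shows "finite (snd H)" "card (snd H) \<le> card (fst H) choose r"
proof -
  have sub: "snd H \<subseteq> {e. e \<subseteq> fst H \<and> card e = r}" and fin: "finite (fst H)"
    using assms by (auto simp: is_r_graph_def)
  have fin': "finite {e. e \<subseteq> fst H \<and> card e = r}" using fin by simp
  show "finite (snd H)" using sub fin' by (rule finite_subset)
  show "card (snd H) \<le> card (fst H) choose r"
    using card_mono[OF fin' sub] n_subsets[OF fin] by simp
qed

lemma finite_free_sizes: "finite (free_sizes r n F)"
proof (rule finite_subset)
  show "free_sizes r n F \<subseteq> {..n choose r}"
    using card_edges_le(2) by (auto simp: free_sizes_def)
qed simp

lemma free_sizes_nonempty:
  assumes "snd F \<noteq> {}"
  shows "free_sizes r n F \<noteq> {}"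
proof -
  let ?H = "({..<n}, {}) :: nat hypergraph"
  have "is_r_graph r ?H" "card (fst ?H) = n" "\<not> contains_copy ?H F"
    using assms by (auto simp: is_r_graph_def contains_copy_def)
  then show ?thesis unfolding free_sizes_def by blast
qed

lemma turan_number_attained:
  assumes "snd F \<noteq> {}"
  obtains H :: "nat hypergraph" where "is_r_graph r H" "card (fst H) = n" "\<not> contains_copy H F"
    "card (snd H) = turan_number r n F"
proof -
  have "turan_number r n F \<in> free_sizes r n F"
    unfolding turan_number_def free_sizes_def[symmetric]
    by (intro Max_in finite_free_sizes free_sizes_nonempty assms)
  then show thesis using that by (auto simp: free_sizes_def)
qed

lemma turan_number_ge:
  fixes H :: "nat hypergraph"
  assumes "is_r_graph r H" "card (fst H) = n" "\<not> contains_copy H F"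
  shows "card (snd H) \<le> turan_number r n F"
  unfolding turan_number_def free_sizes_def[symmetric]
proof (rule Max_ge[OF finite_free_sizes])
  show "card (snd H) \<in> free_sizes r n F"
    unfolding free_sizes_def using assms by (intro CollectI exI[of _ H] conjI refl)
qed

text \<open>Delete each vertex of an extremal graph on n + 1 vertices in turn. All the resulting
  graphs are F-free, and each edge survives in n + 1 - r of them.\<close>

lemma turan_number_Suc_le:
  assumes "snd F \<noteq> {}"
  shows "(Suc n - r) * turan_number r (Suc n) F \<le> Suc n * turan_number r n F"
proof -
  obtain H :: "nat hypergraph" where H: "is_r_graph r H" "card (fst H) = Suc n" "\<not> contains_copy H F"
    "card (snd H) = turan_number r (Suc n) F" using turan_number_attained[OF assms] .
  let ?V = "fst H"
  have fin: "finite ?V" "finite (snd H)" using H(1) card_edges_le(1)[OF H(1)] by (auto simp: is_r_graph_def)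
  have "card {e\<in>snd H. v \<notin> e} \<le> turan_number r n F" if v: "v \<in> ?V" for v
  proof -
    let ?H = "(?V - {v}, {e\<in>snd H. v \<notin> e})"
    have "is_r_graph r ?H" using H(1) by (auto simp: is_r_graph_def)
    moreover have "card (fst ?H) = n" using H(2) v fin by simp
    moreover have "\<not> contains_copy ?H F" using H(3) contains_copy_mono[of ?H F H] by auto
    ultimately show ?thesis using turan_number_ge[of r ?H n F] by simp
  qed
  then have "(\<Sum>v\<in>?V. card {e\<in>snd H. v \<notin> e}) \<le> Suc n * turan_number r n F"
    using sum_bounded_above[of ?V "\<lambda>v. card {e\<in>snd H. v \<notin> e}"] H(2) by simp
  moreover have "(\<Sum>v\<in>?V. card {e\<in>snd H. v \<notin> e}) = (\<Sum>e\<in>snd H. card {v\<in>?V. v \<notin> e})"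
    using fin by (rule sum_card_swap)
  moreover have "(\<Sum>e\<in>snd H. card {v\<in>?V. v \<notin> e}) = (\<Sum>e\<in>snd H. Suc n - r)"
  proof (rule sum.cong[OF refl])
    fix e assume "e \<in> snd H"
    then have e: "e \<subseteq> ?V" "card e = r" using H(1) by (auto simp: is_r_graph_def)
    have "{v\<in>?V. v \<notin> e} = ?V - e" by auto
    then show "card {v\<in>?V. v \<notin> e} = Suc n - r"
      using e H(2) card_Diff_subset[OF finite_subset[OF e(1) fin(1)] e(1)] by simp
  qed
  ultimately show ?thesis using H(4) by (simp add: mult.commute)
qed

lemma turan_ratio_Suc_le:
  assumes "snd F \<noteq> {}" "r \<le> n"
  shows "real (turan_number r (Suc n) F) / real (Suc n choose r) \<le> real (turan_number r n F) / real (n choose r)"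
proof -
  let ?t = "\<lambda>n. real (turan_number r n F)" and ?c = "\<lambda>n. real (n choose r)"
  have pos: "?c n > 0" "?c (Suc n) > 0" using assms(2) by simp_all
  have s: "real (Suc n - r) > 0" using assms(2) by simp
  have c: "real (Suc n - r) * ?c (Suc n) = real (Suc n) * ?c n"
    using binomial_absorb_comp[of "Suc n" r] by (metis diff_Suc_1 of_nat_mult)
  have "real (Suc n - r) * ?t (Suc n) \<le> real (Suc n) * ?t n"
    using turan_number_Suc_le[OF assms(1), of n r] by (metis of_nat_le_iff of_nat_mult)
  then have "(real (Suc n - r) * ?t (Suc n)) * ?c n \<le> (real (Suc n) * ?t n) * ?c n"
    by (rule mult_right_mono) simp
  also have "\<dots> = ?t n * (real (Suc n) * ?c n)" by simp
  also have "\<dots> = real (Suc n - r) * (?t n * ?c (Suc n))" unfolding c[symmetric] by simp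
  finally have "?t (Suc n) * ?c n \<le> ?t n * ?c (Suc n)" using s by (simp add: mult.assoc)
  then show ?thesis using pos by (simp add: frac_le_eq divide_le_eq le_divide_eq mult.commute)
qed

text \<open>The density is defined by \<open>lim\<close>, whose value is known only once convergence
  is proved. Hence the monotonicity of the ratios is needed besides the asymptotic upper
  bound.\<close>

lemma turan_density_le:
  assumes F: "snd F \<noteq> {}"
    and bound: "\<And>\<epsilon>::real. \<epsilon> > 0 \<Longrightarrow> \<exists>N. \<forall>n\<ge>N. \<forall>H :: nat hypergraph.
      is_r_graph r H \<and> card (fst H) = n \<and> \<not> contains_copy H F \<longrightarrow>
      real (card (snd H)) \<le> (\<alpha> + \<epsilon>) * real (n choose r)"
  shows "turan_density r F \<le> \<alpha>"
proof -
  define x where "x n = real (turan_number r n F) / real (n choose r)" for n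
  \<comment> \<open>The shift by r skips the n < r, where \<open>n choose r\<close> is 0 and the
    quotient is 0 by convention, which would break monotonicity.\<close>
  have "decseq (\<lambda>k. x (k + r))"
    using turan_ratio_Suc_le[OF F] by (intro decseq_SucI) (simp add: x_def)
  moreover have "0 \<le> x n" for n by (simp add: x_def)
  ultimately obtain L where "(\<lambda>k. x (k + r)) \<longlonglongrightarrow> L"
    using decseq_convergent[of "\<lambda>k. x (k + r)" 0] by metis
  then have L: "x \<longlonglongrightarrow> L" by (simp add: LIMSEQ_offset)
  have "L \<le> \<alpha> + \<epsilon>" if \<epsilon>: "\<epsilon> > 0" for \<epsilon>
  proof -
    obtain N where N: "\<And>n H. n \<ge> N \<Longrightarrow> is_r_graph r (H :: nat hypergraph) \<Longrightarrow> card (fst H) = n \<Longrightarrow>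
        \<not> contains_copy H F \<Longrightarrow> real (card (snd H)) \<le> (\<alpha> + \<epsilon>) * real (n choose r)"
      using bound[OF \<epsilon>] by blast
    have "x n \<le> \<alpha> + \<epsilon>" if n: "n \<ge> max N r" for n
    proof -
      obtain H :: "nat hypergraph" where "is_r_graph r H" "card (fst H) = n" "\<not> contains_copy H F"
        "card (snd H) = turan_number r n F" using turan_number_attained[OF F] .
      then have "real (turan_number r n F) \<le> (\<alpha> + \<epsilon>) * real (n choose r)" using N[of n H] n by simp
      then show ?thesis using n by (simp add: x_def divide_le_eq)
    qed
    then show ?thesis by (intro LIMSEQ_le_const2[OF L]) blast
  qed
  then have "L \<le> \<alpha>" by (rule field_le_epsilon)
  moreover have "turan_density r F = L"
    unfolding turan_density_def using L by (simp add: x_def[abs_def] limI)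
  ultimately show ?thesis by simp
qed

text \<open>Links two normalizations: counts of maps are compared with n^r, Turan numbers with
  \<open>n choose r\<close>.\<close>

lemma tendsto_fact_binomial_over_power:
  "(\<lambda>n. fact r * real (n choose r) / real n ^ r) \<longlonglongrightarrow> 1"
proof -
  have "(\<lambda>n. \<Prod>i=0..<r. 1 - real i / real n) \<longlonglongrightarrow> (\<Prod>i=0..<r. 1 - 0)"
    by (intro tendsto_prod tendsto_diff tendsto_const lim_const_over_n)
  moreover have "eventually (\<lambda>n. (\<Prod>i=0..<r. 1 - real i / real n) = fact r * real (n choose r) / real n ^ r) sequentially"
    using eventually_gt_at_top[of 0]
  proof eventually_elim
    case (elim n)
    have "fact r * real (n choose r) / real n ^ r = (\<Prod>i=0..<r. real n - real i) / (\<Prod>i=0..<r. real n)"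
      by (simp add: binomial_gbinomial gbinomial_prod_rev)
    also have "\<dots> = (\<Prod>i=0..<r. (real n - real i) / real n)"
      by (rule prod_dividef[symmetric])
    also have "\<dots> = (\<Prod>i=0..<r. 1 - real i / real n)"
      using elim by (simp add: diff_divide_distrib)
    finally show ?case by simp
  qed
  ultimately show ?thesis using Lim_transform_eventually by fastforce
qed

section \<open>The density bound\<close>

text \<open>The product bound applied to the conflict graphs, whose independence ratios are bounded
  by means of \<open>Psi\<close>: a family above the \<alpha>-fraction is not independent.\<close>

lemma conflicting_tuples:
  fixes I :: "'i set" and E :: "'i \<Rightarrow> 'a set" and b :: "'i \<Rightarrow> nat"
  defines "T \<equiv> PiE I (\<lambda>i. {B. B \<subseteq> E i \<and> card B = b i})"
  assumes I: "finite I" and E: "\<And>i. i \<in> I \<Longrightarrow> finite (E i) \<and> card (E i) = r" and \<alpha>: "\<alpha> \<ge> 0"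
    and Psi: "\<And>i. i \<in> I \<Longrightarrow> real (Psi r (b i) (L i)) \<le> \<alpha> * real (r choose b i)"
    and U: "U \<subseteq> T" "\<alpha> * real (card T) < real (card U)"
  obtains S S' where "S \<in> U" "S' \<in> U" "\<And>i. i \<in> I \<Longrightarrow> conflict (L i) (S i) (S' i)"
proof -
  have "\<not> indep (\<lambda>f g. \<forall>i\<in>I. conflict (L i) (f i) (g i)) U"
  proof
    assume "indep (\<lambda>f g. \<forall>i\<in>I. conflict (L i) (f i) (g i)) U"
    then have "real (card U) \<le> \<alpha> * real (card T)"
      unfolding T_def
    proof (rule indep_PiE_bound[OF I \<alpha>, rotated -1])
      fix i assume i: "i \<in> I"
      let ?V = "{B. B \<subseteq> E i \<and> card B = b i}"
      show "finite ?V" using E[OF i] by simp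
      show "symp (conflict (L i))" by (rule symp_conflict)
      show "vertex_transitive ?V (conflict (L i))" using E[OF i] by (intro vertex_transitive_conflict) simp
      fix X assume X: "X \<subseteq> ?V" "indep (conflict (L i)) X"
      then have "card X \<le> Psi r (b i) (L i)"
        using E[OF i] by (intro card_le_Psi[of "E i"]) (simp_all add: indep_conflict_iff)
      then show "real (card X) \<le> \<alpha> * real (card ?V)"
        using Psi[OF i] E[OF i] n_subsets[of "E i" "b i"] by simp
    next
      show "U \<subseteq> (\<Pi>\<^sub>E i\<in>I. {B. B \<subseteq> E i \<and> card B = b i})" using U(1) by (simp add: T_def)
    qed
    with U(2) show False by simp
  qed
  then show thesis using that unfolding indep_def by blast
qed

lemma contains_copy_of_hom:
  fixes V :: "'w set" and F :: "'v hypergraph"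
  assumes T: "is_T r a m b c d F"
    and par: "\<And>i. i \<in> {1..m} \<Longrightarrow> d i \<le> c i \<and> c i \<le> b i"
    and sum: "a + (\<Sum>i\<in>{1..m}. b i) \<le> r"
    and V: "finite V" and H: "\<And>e. e \<in> H \<Longrightarrow> e \<subseteq> V \<and> card e = r"
    and \<alpha>: "\<alpha> \<ge> 0"
    and Psi: "\<And>i. i \<in> {1..m} \<Longrightarrow>
      real (Psi r (b i) ({0..<d i} \<union> {b i - c i + d i + 1..b i})) \<le> \<alpha> * real (r choose b i)"
    and \<rho>: "\<rho> = real (fact r * card H) / real (card V) ^ r"
    and large: "(real (card (fst F)))\<^sup>2 < real (card V) * (\<rho> ^ m * (\<rho> - \<alpha>))"
    and ext: "\<And>S X. S \<in> shadow H \<Longrightarrow> finite X \<Longrightarrow> card X \<le> card (fst F) + r \<Longrightarrow>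
      \<exists>e\<in>H. S \<subseteq> e \<and> (e - S) \<inter> X = {}"
  shows "contains_copy (V, H) F"
proof (rule is_T_elim[OF T])
  let ?I = "{1..m}"
  fix E :: "nat \<Rightarrow> 'v set" and A B C U U'
  assume E: "disjoint_family_on E ?I" "\<And>i. i \<in> ?I \<Longrightarrow> finite (E i) \<and> card (E i) = r"
    and A: "finite A" "card A = a" "A \<inter> (\<Union>i\<in>?I. E i) = {}"
    and BC: "\<And>i. i \<in> ?I \<Longrightarrow> B i \<subseteq> E i \<and> C i \<subseteq> E i \<and> card (B i) = b i \<and> card (C i) = c i \<and> card (B i \<inter> C i) = d i"
    and U: "finite U" "card U = r - card (A \<union> (\<Union>i\<in>?I. B i))" "U \<inter> (A \<union> (\<Union>i\<in>?I. E i)) = {}"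
    and U': "finite U'" "card U' = r - card (A \<union> (\<Union>i\<in>?I. C i))" "U' \<inter> (A \<union> (\<Union>i\<in>?I. E i)) = {}"
      "U \<inter> U' = {}"
    and F: "F = (A \<union> (\<Union>i\<in>?I. E i) \<union> U \<union> U',
          E ` ?I \<union> {A \<union> (\<Union>i\<in>?I. B i) \<union> U, A \<union> (\<Union>i\<in>?I. C i) \<union> U'})"
  define W where "W = A \<union> (\<Union>i\<in>?I. E i)"
  have finE: "finite (E i)" if "i \<in> ?I" for i using E(2)[OF that] by simp
  have finW: "finite W" using A finE by (auto simp: W_def)
  have cardW: "card W \<le> card (fst F)"
    using finW U(1) U'(1) by (intro card_mono) (auto simp: F W_def)
  have finB: "finite (B i)" if "i \<in> ?I" for i
    using BC[OF that] finE[OF that] finite_subset by blast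
  have "disjoint_family_on B ?I"
    using E(1) BC unfolding disjoint_family_on_def by blast
  then have "card (\<Union>i\<in>?I. B i) = (\<Sum>i\<in>?I. card (B i))"
    using finB by (intro card_UN_disjoint') auto
  then have "card (\<Union>i\<in>?I. B i) = (\<Sum>i\<in>?I. b i)" using BC by simp
  moreover have "A \<inter> (\<Union>i\<in>?I. B i) = {}" using A(3) BC by blast
  moreover have "finite (\<Union>i\<in>?I. B i)" using finB by simp
  ultimately have "card (A \<union> (\<Union>i\<in>?I. B i)) = a + (\<Sum>i\<in>?I. b i)"
    using A by (simp add: card_Un_disjoint)
  then have r: "card A + (\<Sum>i\<in>?I. b i) + card U = r" using sum U(2) A(2) by simp
  have br: "b i \<le> r" if "i \<in> ?I" for i
    using BC[OF that] E(2)[OF that] by (metis card_mono)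
  let ?T = "PiE ?I (\<lambda>i. {B. B \<subseteq> E i \<and> card B = b i})"
  have pos: "V \<noteq> {}" using large by auto
  have "(real (card W))\<^sup>2 \<le> (real (card (fst F)))\<^sup>2" using cardW by (intro power_mono) auto
  then have large': "(real (card (A \<union> (\<Union>i\<in>?I. E i))))\<^sup>2 < real (card V) *
      ((real (fact r * card H) / real (card V) ^ r) ^ card ?I * (real (fact r * card H) / real (card V) ^ r - \<alpha>))"
    using large unfolding \<rho> W_def by (simp only: card_atLeastAtMost diff_Suc_1)
  \<comment> \<open>The private set \<open>U\<close> of the edge over the \<open>B i\<close> has
    just the size r - a - (sum of the b_i) needed for padding. Its image under \<phi> is dropped
    afterwards, and \<open>U\<close> is embedded anew together with \<open>U'\<close>.\<close>
  obtain \<phi> where \<phi>: "\<phi> \<in> (W \<union> U) \<rightarrow>\<^sub>E V" "inj_on \<phi> W" "\<forall>i\<in>?I. \<phi> ` E i \<in> H"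
      "\<alpha> * real (card ?T) < real (card {S \<in> ?T. \<phi> ` (A \<union> U \<union> (\<Union>i\<in>?I. S i)) \<in> H})"
    using exists_hom_many_central_edges[OF finite_atLeastAtMost V pos H E(2,1) A(1,3) U(1,3) br r \<alpha> large']
    unfolding W_def by blast
  obtain S S' where S: "S \<in> ?T" "\<phi> ` (A \<union> U \<union> (\<Union>i\<in>?I. S i)) \<in> H"
      "S' \<in> ?T" "\<phi> ` (A \<union> U \<union> (\<Union>i\<in>?I. S' i)) \<in> H"
    and conf: "\<And>i. i \<in> ?I \<Longrightarrow> conflict ({0..<d i} \<union> {b i - c i + d i + 1..b i}) (S i) (S' i)"
    by (rule conflicting_tuples[OF finite_atLeastAtMost E(2) \<alpha> Psi _ \<phi>(4)]) auto
  have "\<exists>p. bij_betw p (E i) (E i) \<and> p ` B i = S i \<and> p ` C i \<subseteq> S' i" if i: "i \<in> ?I" for i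
  proof -
    have Si: "S i \<subseteq> E i" "S' i \<subseteq> E i" "card (S i) = b i" "card (S' i) = b i"
      using S(1,3) i by (auto simp: PiE_iff)
    have fin: "finite (S i)" "finite (S' i)" using Si(1,2) finE[OF i] finite_subset by metis+
    obtain C' where C': "C' \<subseteq> S' i" "card C' = c i" "card (S i \<inter> C') = d i"
      using exists_subset_with_intersection[OF fin(2,1) Si(3,4), of "d i" "c i"] par[OF i] conf[OF i]
      unfolding conflict_def by metis
    obtain p where "bij_betw p (E i) (E i)" "p ` B i = S i" "p ` C i = C'"
    proof (rule bij_betw_matching_two_subsets[OF finE[OF i]])
      show "B i \<subseteq> E i" "C i \<subseteq> E i" using BC[OF i] by auto
      show "S i \<subseteq> E i" "C' \<subseteq> E i" using Si C' by auto
      show "card (B i) = card (S i)" "card (C i) = card C'" "card (B i \<inter> C i) = card (S i \<inter> C')"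
        using BC[OF i] Si C' by auto
    qed
    then show ?thesis using C'(1) by blast
  qed
  then obtain p where p: "\<And>i. i \<in> ?I \<Longrightarrow> bij_betw (p i) (E i) (E i) \<and> p i ` B i = S i \<and> p i ` C i \<subseteq> S' i"
    by metis
  obtain s where s: "bij_betw s W W" "\<And>x. x \<in> A \<Longrightarrow> s x = x" "\<And>i x. i \<in> ?I \<Longrightarrow> x \<in> E i \<Longrightarrow> s x = p i x"
    using bij_betw_family_extend[OF E(1) A(3) finite_atLeastAtMost A(1) finE, of p] p unfolding W_def by blast
  have sA: "s ` A = A" using s(2) by simp
  have sE: "s ` Z = p i ` Z" if "i \<in> ?I" "Z \<subseteq> E i" for i Z
    using s(3)[OF that(1)] that(2) by (intro image_cong) auto
  have sB: "s ` (\<Union>i\<in>?I. B i) = (\<Union>i\<in>?I. S i)" unfolding image_UN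
    using sE BC p by (intro SUP_cong) auto
  have "s ` C i \<subseteq> S' i" if "i \<in> ?I" for i
    using sE[OF that] BC[OF that] p[OF that] by simp
  then have sC: "s ` (\<Union>i\<in>?I. C i) \<subseteq> (\<Union>i\<in>?I. S' i)"
    unfolding image_UN by (intro UN_mono) auto
  \<comment> \<open>Permuting inside each \<open>E i\<close> before applying \<phi> keeps the images
    of the \<open>E i\<close>. It moves the \<open>B i\<close> onto the \<open>S i\<close> and the
    \<open>C i\<close> into the \<open>S' i\<close>, so both central sets land inside edges of
    H.\<close>
  let ?f = "\<phi> \<circ> s"
  have "contains_copy (V, H) (W \<union> U \<union> U', E ` ?I \<union> {A \<union> (\<Union>i\<in>?I. B i) \<union> U, A \<union> (\<Union>i\<in>?I. C i) \<union> U'})"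
  proof (rule contains_copy_extend[OF V H _ finW, where f = ?f])
    show "\<exists>e\<in>H. S \<subseteq> e \<and> (e - S) \<inter> X = {}" if "S \<in> shadow H" "finite X" "card X \<le> card W + r" for S X
      using ext[OF that(1,2)] that(3) cardW by linarith
    show "A \<union> (\<Union>i\<in>?I. B i) \<subseteq> W" "A \<union> (\<Union>i\<in>?I. C i) \<subseteq> W" using BC unfolding W_def by blast+
    show "inj_on ?f W" using s(1) \<phi>(2) by (auto simp: bij_betw_def intro: comp_inj_on)
    have "?f ` W = \<phi> ` W" using s(1) by (metis bij_betw_imp_surj_on image_comp)
    then show "?f ` W \<subseteq> V" using \<phi>(1) by auto
    show "e \<subseteq> W \<and> ?f ` e \<in> H" if e: "e \<in> E ` ?I" for e
    proof -
      obtain i where i: "i \<in> ?I" "e = E i" using e by auto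
      have "?f ` e = \<phi> ` (s ` E i)" by (simp add: i image_comp)
      also have "s ` E i = E i" using sE[OF i(1) subset_refl] p[OF i(1)] by (simp add: bij_betw_def)
      finally show ?thesis using \<phi>(3) i unfolding W_def by auto
    qed
    have fB: "?f ` (A \<union> (\<Union>i\<in>?I. B i)) = \<phi> ` (A \<union> (\<Union>i\<in>?I. S i))"
      by (metis image_comp image_Un sA sB)
    show "?f ` (A \<union> (\<Union>i\<in>?I. B i)) \<in> shadow H"
      unfolding fB shadow_def by (intro CollectI bexI[OF _ S(2)] image_mono) blast
    have fC: "?f ` (A \<union> (\<Union>i\<in>?I. C i)) = \<phi> ` (A \<union> s ` (\<Union>i\<in>?I. C i))"
      by (metis image_comp image_Un sA)
    show "?f ` (A \<union> (\<Union>i\<in>?I. C i)) \<in> shadow H"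
      unfolding fC shadow_def using sC by (intro CollectI bexI[OF _ S(4)] image_mono) blast
  qed (use U U' in \<open>simp_all add: W_def\<close>)
  then show ?thesis by (simp add: F W_def)
qed

theorem theorem1p4:
  fixes m r a :: nat and b c d :: "nat \<Rightarrow> nat" and F :: "'v hypergraph"
  assumes "m \<ge> 1" and "r \<ge> 2"
    and "\<forall>i\<in>{1..m}. d i \<le> c i \<and> c i \<le> b i \<and> b i \<le> r \<and> b i + c i - d i \<le> r"
    and "a + (\<Sum>i\<in>{1..m}. b i) \<le> r"
    and "a + (\<Sum>i\<in>{1..m}. c i) \<le> r"
    and "is_T r a m b c d F"
  shows "turan_density r F
    \<le> Max ((\<lambda>i. real (Psi r (b i) ({0..<d i} \<union> {b i - c i + d i + 1..b i})) / real (r choose b i)) ` {1..m})"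
    (is "_ \<le> Max (?g ` _)")
proof (rule turan_density_le)
  define \<alpha> where "\<alpha> = Max (?g ` {1..m})"
  have g: "?g i \<le> \<alpha>" if "i \<in> {1..m}" for i using that by (simp add: \<alpha>_def)
  have \<alpha>: "\<alpha> \<ge> 0" using g[of 1] \<open>m \<ge> 1\<close> by (meson atLeastAtMost_iff divide_nonneg_nonneg le_refl of_nat_0_le_iff order_trans)
  show "snd F \<noteq> {}" by (rule is_T_elim[OF assms(6)]) auto
  fix \<epsilon> :: real assume \<epsilon>: "\<epsilon> > 0"
  define k where "k = card (fst F)"
  \<comment> \<open>Cleaning loses at most (r + 1) \<eta> n^r edges, that is r! (r + 1) \<eta> =
    \<epsilon>/4 in \<rho>. Replacing \<open>n choose r\<close> by n^r / r! costs at most another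
    \<epsilon>/4, so \<rho> \<ge> \<alpha> + \<epsilon>/2 remains.\<close>
  define \<eta> where "\<eta> = \<epsilon> / (4 * (fact r * real (r + 1)))"
  have \<eta>: "\<eta> > 0" using \<epsilon> by (simp add: \<eta>_def)
  have "(\<lambda>n. (\<alpha> + \<epsilon>) * (fact r * real (n choose r) / real n ^ r)) \<longlonglongrightarrow> (\<alpha> + \<epsilon>) * 1"
    by (intro tendsto_mult tendsto_const tendsto_fact_binomial_over_power)
  then have "eventually (\<lambda>n. \<alpha> + 3 * \<epsilon> / 4 < (\<alpha> + \<epsilon>) * (fact r * real (n choose r) / real n ^ r)) sequentially"
    using \<epsilon> by (intro order_tendstoD) auto
  moreover have "eventually (\<lambda>n. x < real n * y) sequentially" if "y > 0" for x y
    using that filterlim_tendsto_pos_mult_at_top[OF tendsto_const that filterlim_real_sequentially]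
    by (auto simp: filterlim_at_top_dense mult.commute)
  \<comment> \<open>Both \<rho> and \<rho> - \<alpha> will be at least \<epsilon>/2, so the first
    condition implies the size condition of the embedding uniformly in the host graph. The second
    lets edges avoid any k + r given vertices.\<close>
  then have "eventually (\<lambda>n. real k ^ 2 < real n * ((\<epsilon> / 2) ^ m * (\<epsilon> / 2))) sequentially"
    "eventually (\<lambda>n. real (k + r) < real n * \<eta>) sequentially"
    using \<epsilon> \<eta> by simp_all
  ultimately have "eventually (\<lambda>n. \<forall>H :: nat hypergraph. is_r_graph r H \<and> card (fst H) = n \<and> \<not> contains_copy H F \<longrightarrow>
      real (card (snd H)) \<le> (\<alpha> + \<epsilon>) * real (n choose r)) sequentially"
    using eventually_gt_at_top[of 0]
  proof eventually_elim
    case (elim n)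
    show ?case
    proof (intro allI impI, rule ccontr)
      fix H :: "nat hypergraph"
      assume H: "is_r_graph r H \<and> card (fst H) = n \<and> \<not> contains_copy H F"
        and dense: "\<not> real (card (snd H)) \<le> (\<alpha> + \<epsilon>) * real (n choose r)"
      have fin: "finite (fst H)" and edges: "\<And>e. e \<in> snd H \<Longrightarrow> e \<subseteq> fst H \<and> card e = r"
        using H by (auto simp: is_r_graph_def)
      obtain G where G: "G \<subseteq> snd H"
          "real (card (snd H)) \<le> real (card G) + real (r + 1) * \<eta> * real n ^ r"
          "\<And>S. S \<in> shadow G \<Longrightarrow> \<eta> * real n ^ (r - card S) \<le> real (codeg G S)"
        using exists_cleaned_subgraph[OF fin edges, where \<eta> = \<eta>] \<eta> H by (metis less_imp_le)
      define \<rho> where "\<rho> = real (fact r * card G) / real (card (fst H)) ^ r"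
      have "(\<alpha> + \<epsilon>) * (fact r * real (n choose r) / real n ^ r) = fact r / real n ^ r * ((\<alpha> + \<epsilon>) * real (n choose r))"
        by simp
      also have "\<dots> \<le> fact r / real n ^ r * (real (card G) + real (r + 1) * \<eta> * real n ^ r)"
        using G(2) dense by (intro mult_left_mono) auto
      also have "\<dots> = \<rho> + fact r * real (r + 1) * \<eta>"
        using elim H by (simp add: \<rho>_def field_simps)
      also have "fact r * real (r + 1) * \<eta> = \<epsilon> / 4"
      proof -
        have "D * (\<epsilon> / (4 * D)) = \<epsilon> / 4" if "D \<noteq> 0" for D :: real using that by simp
        from this[of "fact r * real (r + 1)"] show ?thesis by (simp only: \<eta>_def) simp
      qed
      finally have \<rho>: "\<rho> \<ge> \<alpha> + \<epsilon> / 2" using elim(1) by simp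
      have "real k ^ 2 < real n * ((\<epsilon> / 2) ^ m * (\<epsilon> / 2))" by (rule elim)
      also have "\<dots> \<le> real n * (\<rho> ^ m * (\<rho> - \<alpha>))"
        using \<rho> \<alpha> \<epsilon> by (intro mult_left_mono mult_mono power_mono) auto
      finally have large: "(real (card (fst F)))\<^sup>2 < real (card (fst H)) * (\<rho> ^ m * (\<rho> - \<alpha>))"
        using H by (simp add: k_def)
      have "contains_copy (fst H, G) F"
      proof (rule contains_copy_of_hom[OF assms(6) _ assms(4) fin _ \<alpha> _ \<rho>_def large])
        show "e \<subseteq> fst H \<and> card e = r" if "e \<in> G" for e using edges G(1) that by auto
        show "d i \<le> c i \<and> c i \<le> b i" if "i \<in> {1..m}" for i using assms(3) that by auto
        show "real (Psi r (b i) ({0..<d i} \<union> {b i - c i + d i + 1..b i})) \<le> \<alpha> * real (r choose b i)"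
          if "i \<in> {1..m}" for i
          using g[OF that] assms(3) that by (simp add: divide_le_eq)
        fix S X :: "nat set" assume S: "S \<in> shadow G" and X: "finite X" "card X \<le> card (fst F) + r"
        have "real (card X) < \<eta> * real (card (fst H))"
          using elim(3) X(2) H by (simp add: k_def mult.commute)
        moreover have "\<eta> * real (card (fst H)) ^ (r - card S) \<le> real (codeg G S)" using G(3)[OF S] H by simp
        ultimately show "\<exists>e\<in>G. S \<subseteq> e \<and> (e - S) \<inter> X = {}"
          using exists_edge_avoiding[OF fin _ S _ X(1), of r \<eta>] edges G(1) by (metis subsetD)
      qed
      then show False using H G(1) contains_copy_mono[of "(fst H, G)" F H] by simp
    qed
  qed
  then show "\<exists>N. \<forall>n\<ge>N. \<forall>H :: nat hypergraph. is_r_graph r H \<and> card (fst H) = n \<and> \<not> contains_copy H F \<longrightarrow>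
      real (card (snd H)) \<le> (Max (?g ` {1..m}) + \<epsilon>) * real (n choose r)"
    by (simp add: eventually_sequentially \<alpha>_def)
qed

end
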